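(* Consider the AD model on the infinite rooted binary tree $\mathcal{T}$ with parameter $p\in[0,1]$ and reversible Bernoulli($p$) product measure $\mu$, let $p_c=1/2$ be its ergodicity threshold, and let $\nu$ be the Bernoulli($p'$) product measure on $\{0,1\}^{\mathcal{T}}$, $p'\in[0,1]$. If $p\le p_c<p'$, then for any $c>0$ there exists a local function $f$ such that for all $t>0$ $$\Bigl|\int d\nu(\eta)\,\mathbb{E}\bigl(f(\eta_t)-\mu(f)\bigr)\Bigr|\ge c.$$
   Context: Let $\mathcal{T}$ be the infinite rooted binary tree (each vertex has two children), with root $0$; let $\Omega=\{0,1\}^{\mathcal{T}}$ and let $\mu=\bigotimes_{x\in\mathcal{T}}\mu_x$ be the product measure with each $\mu_x$ Bernoulli($p$) on $\{0,1\}$ (value $1$ with probability $p$). A function $f:\Omega\to\mathbb{R}$ is local if it depends on finitely many variables. The AD model is the Markov process on $\Omega$ whose generator acts on local functions by $$\mathcal{L}f(\omega)=\sum_{x\in\mathcal{T}}c_x(\omega)\,[\mu_x(f)-f(\omega)],$$ where $\mu_x(f)=\int d\mu_x(\omega_x)f(\omega)$ averages over $\omega_x$ only, all other variables being held fixed, and $c_x(\omega)=1$ if $\omega$ is $0$ at both children of $x$, $c_x(\omega)=0$ otherwise. For a function $g$, $\mathbb{E}(g(\eta_t))$ denotes the expectation of $g$ at time $t$ over the process started from $\eta$. The threshold is $p_c=\sup\{p\in[0,1]: 0 \text{ is a simple eigenvalue of } \mathcal{L}\}$, with $\mathcal{L}$ regarded as a self-adjoint operator on $L^2(\Omega,\mu)$;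 it is known to equal the critical density for (oriented, parent-to-child) site percolation on $\mathcal{T}$, which is $1/2$. *)

theory Defs
  imports "HOL-Probability.Probability"
begin

text \<open>
  A vertex of the infinite rooted binary tree is the list of left/right choices leading to it,
  most recent choice first; the root is the empty list.  A configuration takes the value 1 at
  a vertex iff it is \<open>True\<close> there.  The type of configurations carries the product topology of
  the library (with \<open>bool\<close> discrete), so it is compact.
\<close>

type_synonym vertex = "bool list"
type_synonym config = "vertex \<Rightarrow> bool"

definition children :: "vertex \<Rightarrow> vertex set" where
  "children x = {b # x | b. True}"

definition bernoulli_product :: "real \<Rightarrow> config measure" where
  "bernoulli_product p = Pi\<^sub>M UNIV (\<lambda>x. measure_pmf (bernoulli_pmf p))"

definition local_function :: "(config \<Rightarrow> real) \<Rightarrow> bool" where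
  "local_function f \<longleftrightarrow>
     (\<exists>S. finite S \<and> (\<forall>\<omega> \<omega>'. (\<forall>x\<in>S. \<omega> x = \<omega>' x) \<longrightarrow> f \<omega> = f \<omega>'))"

definition ad_rate :: "vertex \<Rightarrow> config \<Rightarrow> real" where
  "ad_rate x \<omega> = (if \<forall>y\<in>children x. \<not> \<omega> y then 1 else 0)"

definition site_average :: "real \<Rightarrow> vertex \<Rightarrow> (config \<Rightarrow> real) \<Rightarrow> config \<Rightarrow> real" where
  "site_average p x f \<omega> = measure_pmf.expectation (bernoulli_pmf p) (\<lambda>b. f (fun_upd \<omega> x b))"

text \<open>For a local function only finitely many terms of the following sum are nonzero.\<close>

definition ad_generator :: "real \<Rightarrow> (config \<Rightarrow> real) \<Rightarrow> config \<Rightarrow> real" where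
  "ad_generator p f \<omega> = (\<Sum>\<^sub>\<infinity>x\<in>UNIV. ad_rate x \<omega> * (site_average p x f \<omega> - f \<omega>))"

text \<open>
  A Markov process on configurations is given by a law \<open>M \<eta>\<close> for every starting point \<open>\<eta>\<close> and
  random variables \<open>X t\<close>, \<open>t \<ge> 0\<close>, on the common sample space.
\<close>

definition natural_sigma :: "'w measure \<Rightarrow> (real \<Rightarrow> 'w \<Rightarrow> config) \<Rightarrow> real \<Rightarrow> 'w measure" where
  "natural_sigma N X s =
     sigma (space N) {X u -` B \<inter> space N | u B. 0 \<le> u \<and> u \<le> s \<and> B \<in> sets borel}"

definition transition ::
  "(config \<Rightarrow> 'w measure) \<Rightarrow> (real \<Rightarrow> 'w \<Rightarrow> config) \<Rightarrow> real \<Rightarrow> (config \<Rightarrow> real) \<Rightarrow> config \<Rightarrow> real" where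
  "transition M X t f \<eta> = (\<integral>w. f (X t w) \<partial>M \<eta>)"

definition feller_markov_process ::
  "(config \<Rightarrow> 'w measure) \<Rightarrow> (real \<Rightarrow> 'w \<Rightarrow> config) \<Rightarrow> bool" where
  "feller_markov_process M X \<longleftrightarrow>
     (\<forall>\<eta>. prob_space (M \<eta>)) \<and>
     (\<forall>\<eta>. \<forall>t\<ge>0. X t \<in> measurable (M \<eta>) borel) \<and>
     (\<forall>\<eta>. AE w in M \<eta>. X 0 w = \<eta>) \<and>
     (\<forall>f. \<forall>t\<ge>0. continuous_on UNIV f \<longrightarrow> continuous_on UNIV (transition M X t f)) \<and>
     (\<forall>\<eta> f. \<forall>s\<ge>0. \<forall>t\<ge>0. continuous_on UNIV f \<longrightarrow>
        (AE w in M \<eta>.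
           real_cond_exp (M \<eta>) (natural_sigma (M \<eta>) X s) (\<lambda>w. f (X (s + t) w)) w
             = transition M X t f (X s w)))"

text \<open>
  The generator is the derivative at time 0, in the supremum norm, of the semigroup on continuous
  functions.  The closure of \<open>ad_generator p\<close> on local functions is itself a Markov generator,
  so the condition below determines the transition probabilities uniquely.
\<close>

definition ad_process ::
  "real \<Rightarrow> (config \<Rightarrow> 'w measure) \<Rightarrow> (real \<Rightarrow> 'w \<Rightarrow> config) \<Rightarrow> bool" where
  "ad_process p M X \<longleftrightarrow>
     feller_markov_process M X \<and>
     (\<forall>f. local_function f \<longrightarrow>
        uniform_limit UNIV (\<lambda>t \<eta>. (transition M X t f \<eta> - f \<eta>) / t) (ad_generator p f)
          (at_right 0))"

definition in_L2 :: "real \<Rightarrow> (config \<Rightarrow> real) \<Rightarrow> bool" where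
  "in_L2 p f \<longleftrightarrow> f \<in> borel_measurable (bernoulli_product p) \<and>
     integrable (bernoulli_product p) (\<lambda>\<omega>. (f \<omega>)\<^sup>2)"

text \<open>
  The graph of the self-adjoint operator on \<open>L\<^sup>2\<close>: the generator is essentially self-adjoint on
  local functions, so this operator is its \<open>L\<^sup>2\<close>-closure.
\<close>

definition ad_L2_graph :: "real \<Rightarrow> (config \<Rightarrow> real) \<Rightarrow> (config \<Rightarrow> real) \<Rightarrow> bool" where
  "ad_L2_graph p f g \<longleftrightarrow> in_L2 p f \<and> in_L2 p g \<and>
     (\<exists>F. (\<forall>n::nat. local_function (F n)) \<and>
        (\<lambda>n. \<integral>\<omega>. (F n \<omega> - f \<omega>)\<^sup>2 \<partial>bernoulli_product p) \<longlonglongrightarrow> 0 \<and>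
        (\<lambda>n. \<integral>\<omega>. (ad_generator p (F n) \<omega> - g \<omega>)\<^sup>2 \<partial>bernoulli_product p) \<longlonglongrightarrow> 0)"

definition ad_simple_eigenvalue :: "real \<Rightarrow> real \<Rightarrow> bool" where
  "ad_simple_eigenvalue p l \<longleftrightarrow>
     (\<exists>f. ad_L2_graph p f (\<lambda>\<omega>. l * f \<omega>) \<and>
        \<not> (AE \<omega> in bernoulli_product p. f \<omega> = 0) \<and>
        (\<forall>g. ad_L2_graph p g (\<lambda>\<omega>. l * g \<omega>) \<longrightarrow>
           (\<exists>a. AE \<omega> in bernoulli_product p. g \<omega> = a * f \<omega>)))"

text \<open>
  The ergodicity threshold \<open>p\<^sub>c\<close>, whose value is known to be 1/2.  The value \<open>p = 1\<close> has to be
  left out of the supremum: there the product measure is a point mass, \<open>L\<^sup>2\<close> is one-dimensional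
  and 0 is trivially a simple eigenvalue, so that including it would make the supremum 1.
\<close>

definition ad_threshold :: real where
  "ad_threshold = Sup {p. 0 \<le> p \<and> p < 1 \<and> ad_simple_eigenvalue p 0}"

end

theory Submission
  imports Defs
begin

text \<open>
  Let \<open>u\<^sub>n\<close> be the indicator that no path of ones of length \<open>n\<close> descends from the root. A vertex
  on an infinite path of ones has a child with value 1 at all times, so such a path is frozen by the
  dynamics, and the mean of \<open>u\<^sub>n\<close> under the process started from \<open>\<nu>\<close> never exceeds the
  extinction probability of the branching process with parameter \<open>p'\<close>, which is less than 1.
  For \<open>p \<le> 1/2\<close>, on the other hand, \<open>\<mu>(u\<^sub>n) \<rightarrow> 1\<close>, so a large multiple of
  \<open>u\<^sub>n\<close>, for \<open>n\<close> large, is the required function.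

  That the threshold equals 1/2 is part of the proof. For \<open>p > 1/2\<close> the indicator of extinction is a second
  element of the kernel. For \<open>p < 1/2\<close> the Dirichlet form shows that an element of the kernel is
  invariant under legal moves; as clusters are finite, legal moves suffice to empty any vertex, so
  the element is invariant under changes of single sites and hence constant.
\<close>

section \<open>Local functions and resampling of one site\<close>

text \<open>Extinction is not a local function, and the process is given through its semigroup, with
  no regularity of paths. Both uses of frozen paths therefore go through the truncations
  \<open>u n x\<close>, on which the generator L has two properties. First, L u_n \<le> u_(n+1) -
  u_n. This replaces following trajectories: a survivor has u_n = 0 at time 0 for every n, and the
  inequality bounds any growth of u_n by u_(n+1), one level deeper. Second, L obeys a product rule
  over the two subtrees of a vertex. It turns the L2 norm of L u_n into a recursion with factor 2 p
  q_n, up to a source term, where q_n is the mean of u_n. For p > 1/2 this factor is at most 2 (1 -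
  p) < 1, because q_n stays below the fixed point (1 - p) / p of the extinction recursion. So the
  norm tends to 0, which places the extinction indicator in the kernel of the closed operator. The
  theorem allows p to equal the threshold, where survival to depth n does not decay exponentially;
  the bound 2 / (n + 2) covers this case.\<close>

instance bool :: second_countable_topology
proof
  have "open U \<longleftrightarrow> generate_topology UNIV U" for U :: "bool set"
    by (simp add: open_bool_def[symmetric] generate_topology.Basis Topological_Spaces.open_discrete)
  then show "\<exists>B::bool set set. countable B \<and> open = generate_topology B"
    by (intro exI[of _ UNIV]) auto
qed

definition depends_on :: "vertex set \<Rightarrow> (config \<Rightarrow> 'a) \<Rightarrow> bool" where
  "depends_on S f \<longleftrightarrow> (\<forall>w w'. (\<forall>x\<in>S. w x = w' x) \<longrightarrow> f w = f w')"

lemma local_function_iff: "local_function f \<longleftrightarrow> (\<exists>S. finite S \<and> depends_on S f)"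
  by (simp add: local_function_def depends_on_def)

lemma depends_on_mono: "depends_on S f \<Longrightarrow> S \<subseteq> T \<Longrightarrow> depends_on T f"
  unfolding depends_on_def by blast

lemma depends_on_cong: "depends_on S f \<Longrightarrow> (\<And>x. x \<in> S \<Longrightarrow> w x = w' x) \<Longrightarrow> f w = f w'"
  unfolding depends_on_def by blast

lemma depends_on_upd: "depends_on S f \<Longrightarrow> x \<notin> S \<Longrightarrow> f (w(x := b)) = f w"
  by (erule depends_on_cong) auto

lemma depends_on_const: "depends_on S (\<lambda>_. a)"
  by (simp add: depends_on_def)

lemma depends_on_comp: "depends_on S f \<Longrightarrow> depends_on S (\<lambda>w. h (f w))"
  by (simp add: depends_on_def) (intro allI impI arg_cong[where f = h], blast)

lemma depends_on_comp2:
  "depends_on S f \<Longrightarrow> depends_on S g \<Longrightarrow> depends_on S (\<lambda>w. h (f w) (g w))"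
  by (simp add: depends_on_def) (intro allI impI arg_cong2[where f = h], blast+)

text \<open>Cylinder sets are open, so a local function is locally constant. This brings local
  functions within reach of the Feller and Markov properties, which speak of continuous
  functions.\<close>

lemma continuous_on_local:
  fixes f :: "config \<Rightarrow> 'a::topological_space"
  assumes "finite S" "depends_on S f"
  shows "continuous_on UNIV f"
proof -
  have "(f \<longlongrightarrow> f w) (at w)" for w
  proof (rule tendsto_eventually)
    have "open (\<Inter>x\<in>S. (\<lambda>w'. w' x) -` {w x})"
      using assms(1) by (intro open_INT ballI open_vimage continuous_on_product_coordinates)
        (auto intro: Topological_Spaces.open_discrete)
    then show "eventually (\<lambda>w'. f w' = f w) (at w)"
      unfolding eventually_at_topological
      by (rule_tac exI) (auto intro: depends_on_cong[OF assms(2)])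
  qed
  then show ?thesis by (simp add: continuous_on_def)
qed

lemma finite_range_local:
  assumes "finite S" "depends_on S f"
  shows "finite (range f)"
proof -
  have "f w \<in> (\<lambda>A. f (\<lambda>x. x \<in> A)) ` Pow S" for w
  proof (rule image_eqI)
    show "f w = f (\<lambda>x. x \<in> {x\<in>S. w x})" by (rule depends_on_cong[OF assms(2)]) simp
  qed blast
  then have "range f \<subseteq> (\<lambda>A. f (\<lambda>x. x \<in> A)) ` Pow S" by blast
  then show ?thesis by (rule finite_subset) (simp add: assms(1))
qed

lemma bounded_local:
  fixes f :: "config \<Rightarrow> real"
  assumes "finite S" "depends_on S f"
  obtains C where "\<And>w. \<bar>f w\<bar> \<le> C"
proof
  fix w show "\<bar>f w\<bar> \<le> Max ((\<lambda>a. \<bar>a\<bar>) ` range f)"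
    using finite_range_local[OF assms] by (intro Max_ge) auto
qed

text \<open>There are countably many vertices and \<open>bool\<close> is second countable, which is
  the purpose of the instance above. Through this identity the functions
  \<open>transition M X t f\<close>, known only to be continuous, can be integrated against the
  product measure.\<close>

lemma sets_bernoulli_product: "sets (bernoulli_product p) = sets borel"
proof -
  have "sets (borel :: bool measure) = UNIV"
    by (simp add: sets_borel_eq_count_space)
  then have "sets (bernoulli_product p) = sets (Pi\<^sub>M UNIV (\<lambda>x::vertex. borel :: bool measure))"
    unfolding bernoulli_product_def by (intro sets_PiM_cong) auto
  also have "\<dots> = sets borel" by (rule sets_PiM_equal_borel)
  finally show ?thesis .
qed

lemma space_bernoulli_product [simp]: "space (bernoulli_product p) = UNIV"
  by (simp add: bernoulli_product_def space_PiM)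

lemma measurable_bernoulli_product:
  "f \<in> measurable (bernoulli_product p) N \<longleftrightarrow> f \<in> measurable borel N"
  using measurable_cong_sets[OF sets_bernoulli_product refl] by blast

lemma borel_measurable_bernoulli_product:
  fixes f :: "config \<Rightarrow> real"
  shows "continuous_on UNIV f \<Longrightarrow> f \<in> borel_measurable (bernoulli_product p)"
  by (simp add: measurable_bernoulli_product borel_measurable_continuous_onI)

lemma prob_space_bernoulli_product: "prob_space (bernoulli_product p)"
  unfolding bernoulli_product_def by (intro prob_space_PiM prob_space_measure_pmf)

lemma measure_UNIV_bernoulli_product [simp]: "measure (bernoulli_product p) UNIV = 1"
  using prob_space.prob_space[OF prob_space_bernoulli_product] by simp

interpretation bernoulli: prob_space "bernoulli_product p" for p
  by (rule prob_space_bernoulli_product)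

lemma measurable_local:
  fixes f :: "config \<Rightarrow> real"
  assumes "finite S" "depends_on S f"
  shows "f \<in> borel_measurable (bernoulli_product p)"
  using continuous_on_local[OF assms] by (rule borel_measurable_bernoulli_product)

lemma integrable_local:
  fixes f :: "config \<Rightarrow> real"
  assumes "finite S" "depends_on S f"
  shows "integrable (bernoulli_product p) f"
proof -
  obtain C where "\<And>w. \<bar>f w\<bar> \<le> C" by (rule bounded_local[OF assms]) blast
  then show ?thesis
    by (intro bernoulli.integrable_const_bound[of _ C] measurable_local[OF assms]) auto
qed

lemma integrable_local_mult:
  fixes f g :: "config \<Rightarrow> real"
  assumes "finite S" "depends_on S f" "integrable (bernoulli_product p) g"
  shows "integrable (bernoulli_product p) (\<lambda>w. f w * g w)"
proof -
  obtain C where C: "\<And>w. \<bar>f w\<bar> \<le> C" by (rule bounded_local[OF assms(1,2)]) blast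
  have [measurable]: "f \<in> borel_measurable (bernoulli_product p)"
    by (rule measurable_local[OF assms(1,2)])
  have [measurable]: "g \<in> borel_measurable (bernoulli_product p)" using assms(3) by simp
  show ?thesis
  proof (rule Bochner_Integration.integrable_bound)
    show "integrable (bernoulli_product p) (\<lambda>w. C * \<bar>g w\<bar>)" using assms(3) by simp
    show "AE w in bernoulli_product p. norm (f w * g w) \<le> norm (C * \<bar>g w\<bar>)"
    proof (rule AE_I2)
      fix w
      have "\<bar>f w\<bar> * \<bar>g w\<bar> \<le> \<bar>C\<bar> * \<bar>g w\<bar>" using C[of w] by (intro mult_right_mono) auto
      then show "norm (f w * g w) \<le> norm (C * \<bar>g w\<bar>)" by (simp add: abs_mult)
    qed
  qed simp
qed

section \<open>Resampling a single coordinate\<close>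

lemma measurable_resample:
  "(\<lambda>(b, w). w(x := b)) \<in>
     measurable (measure_pmf (bernoulli_pmf p) \<Otimes>\<^sub>M bernoulli_product p) (bernoulli_product p)"
  unfolding bernoulli_product_def split_beta
proof (rule measurable_PiM_single')
  show "(\<lambda>z. ((snd z)(x := fst z)) y) \<in> measurable (measure_pmf (bernoulli_pmf p) \<Otimes>\<^sub>M
      Pi\<^sub>M UNIV (\<lambda>x. measure_pmf (bernoulli_pmf p))) (measure_pmf (bernoulli_pmf p))"
    for y :: vertex
    by (cases "y = x") (auto intro!: measurable_compose[OF measurable_snd] measurable_component_singleton)
qed auto

text \<open>A coordinate of a product measure is independent of the others, so redrawing it from its
  own law changes nothing. The later factorisations of integrals are iterations of this
  identity.\<close>

lemma distr_resample:
  "distr (measure_pmf (bernoulli_pmf p) \<Otimes>\<^sub>M bernoulli_product p) (bernoulli_product p)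
     (\<lambda>(b, w). w(x := b)) = bernoulli_product p"
  using distr_pair_PiM_eq_PiM[of "UNIV :: vertex set" "\<lambda>_. measure_pmf (bernoulli_pmf p)" x]
  by (simp add: bernoulli_product_def prob_space_measure_pmf)

interpretation resample: pair_prob_space "measure_pmf (bernoulli_pmf p)" "bernoulli_product p" for p
  by unfold_locales

lemma AE_resample:
  assumes "AE w in bernoulli_product p. P w" "b \<in> set_pmf (bernoulli_pmf p)"
  shows "AE w in bernoulli_product p. P (w(x := b))"
proof -
  have "AE z in measure_pmf (bernoulli_pmf p) \<Otimes>\<^sub>M bernoulli_product p.
      P ((\<lambda>(b, w). w(x := b)) z)"
    using assms(1) by (intro AE_distrD[OF measurable_resample], subst distr_resample)
  then have "AE b in measure_pmf (bernoulli_pmf p). AE w in bernoulli_product p. P (w(x := b))"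
    using resample.AE_pair by fastforce
  with assms(2) show ?thesis by (simp add: AE_measure_pmf_iff)
qed

text \<open>For p < 1 the value 0 has positive probability, so null sets pull back to null sets when
  a site is emptied. Almost sure invariances can therefore be composed along a finite sequence of
  emptied sites.\<close>

lemma AE_upd_False:
  assumes "AE w in bernoulli_product p. P w" "0 \<le> p" "p < 1"
  shows "AE w in bernoulli_product p. P (w(x := False))"
  using assms by (intro AE_resample) (auto simp: set_pmf_iff)

lemma site_average_eq:
  assumes "0 \<le> p" "p \<le> 1"
  shows "site_average p x f w = p * f (w(x := True)) + (1 - p) * f (w(x := False))"
  using assms by (simp add: site_average_def)

lemma
  fixes f :: "config \<Rightarrow> real"
  assumes "integrable (bernoulli_product p) f"
  shows integrable_site_average: "integrable (bernoulli_product p) (site_average p x f)"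
    and integral_site_average:
      "(\<integral>w. site_average p x f w \<partial>bernoulli_product p) = (\<integral>w. f w \<partial>bernoulli_product p)"
    and integrable_resample:
      "b \<in> set_pmf (bernoulli_pmf p) \<Longrightarrow> integrable (bernoulli_product p) (\<lambda>w. f (w(x := b)))"
proof -
  let ?M = "measure_pmf (bernoulli_pmf p) \<Otimes>\<^sub>M bernoulli_product p"
  have f: "f \<in> borel_measurable (bernoulli_product p)" using assms by simp
  have "integrable ?M (\<lambda>z. f ((\<lambda>(b, w). w(x := b)) z))"
    using assms by (subst integrable_distr_eq[OF measurable_resample f, symmetric])
      (simp add: distr_resample)
  then have int: "integrable ?M (\<lambda>(b, w). f (w(x := b)))"
    by (simp add: case_prod_unfold)
  show "integrable (bernoulli_product p) (site_average p x f)"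
    unfolding site_average_def using resample.integrable_snd[OF int] by simp
  have "(\<integral>w. site_average p x f w \<partial>bernoulli_product p) = (\<integral>z. f ((\<lambda>(b, w). w(x := b)) z) \<partial>?M)"
    unfolding site_average_def using resample.integral_snd[OF int] by (simp add: case_prod_unfold)
  also have "\<dots> = (\<integral>w. f w \<partial>bernoulli_product p)"
    by (subst integral_distr[OF measurable_resample f, symmetric]) (simp add: distr_resample)
  finally show "(\<integral>w. site_average p x f w \<partial>bernoulli_product p) = (\<integral>w. f w \<partial>bernoulli_product p)" .
  show "integrable (bernoulli_product p) (\<lambda>w. f (w(x := b)))"
    if "b \<in> set_pmf (bernoulli_pmf p)"
    using resample.AE_integrable_fst[OF int] that by (simp add: AE_measure_pmf_iff)
qed

lemma depends_on_site_average:
  assumes "depends_on (insert x S) f"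
  shows "depends_on S (site_average p x f)"
  unfolding depends_on_def
proof (intro allI impI)
  fix w w' :: config
  assume "\<forall>y\<in>S. w y = w' y"
  then have "f (w(x := b)) = f (w'(x := b))" for b
    by (intro depends_on_cong[OF assms]) auto
  then show "site_average p x f w = site_average p x f w'"
    by (simp add: site_average_def)
qed

text \<open>
  Averaging the sites of \<open>S\<close> one after the other turns \<open>F\<close> into the constant \<open>\<integral>F\<close>; the
  factor \<open>f\<close> can be pulled out of each average.
\<close>

lemma integral_mult_invariant:
  fixes f F :: "config \<Rightarrow> real"
  assumes "finite S" "depends_on S F"
    and "0 \<le> p" "p \<le> 1"
    and int: "integrable (bernoulli_product p) f"
    and inv: "\<And>x. x \<in> S \<Longrightarrow> AE w in bernoulli_product p. f (w(x := False)) = f w"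
  shows "(\<integral>w. F w * f w \<partial>bernoulli_product p) =
    (\<integral>w. F w \<partial>bernoulli_product p) * (\<integral>w. f w \<partial>bernoulli_product p)"
  using assms(1,2) inv
proof (induction S arbitrary: F)
  case empty
  then have "F = (\<lambda>_. F (\<lambda>_. False))" by (auto simp: depends_on_def)
  then obtain a where F: "F = (\<lambda>_. a)" by blast
  show ?case unfolding F by (simp add: bernoulli.prob_space)
next
  case (insert x S)
  let ?B = "bernoulli_product p"
  have fin: "finite (insert x S)" using insert by simp
  \<comment> \<open>Apply the invariance at \<open>w(x := b)\<close>: emptying x erases b, so
    \<open>f (w(x := b))\<close> and \<open>f w\<close> both equal
    \<open>f (w(x := False))\<close>.\<close>
  have inv': "AE w in ?B. f (w(x := b)) = f w" if b: "b \<in> set_pmf (bernoulli_pmf p)" for b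
  proof -
    have "AE w in ?B. f (w(x := False)) = f w" by (rule insert.prems(2)) simp
    from AE_resample[OF this b, of x] this show ?thesis by eventually_elim simp
  qed
  have "AE w in ?B. \<forall>b\<in>set_pmf (bernoulli_pmf p). f (w(x := b)) = f w"
    using inv' by (intro AE_finite_allI) auto
  then have "AE w in ?B. site_average p x (\<lambda>w. F w * f w) w = site_average p x F w * f w"
  proof eventually_elim
    case (elim w)
    have "site_average p x (\<lambda>w. F w * f w) w =
        measure_pmf.expectation (bernoulli_pmf p) (\<lambda>b. F (w(x := b)) * f w)"
      unfolding site_average_def
      using elim by (intro integral_cong_AE) (auto simp: AE_measure_pmf_iff)
    then show ?case by (simp add: site_average_def)
  qed
  moreover have intF: "integrable ?B (\<lambda>w. F w * f w)"
    by (rule integrable_local_mult[OF fin insert.prems(1) int])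
  moreover have "integrable ?B (\<lambda>w. site_average p x F w * f w)"
    using insert by (intro integrable_local_mult[of S] int depends_on_site_average) auto
  ultimately have "(\<integral>w. F w * f w \<partial>?B) = (\<integral>w. site_average p x F w * f w \<partial>?B)"
    by (subst integral_site_average[OF intF, symmetric], intro integral_cong_AE)
      (auto intro: borel_measurable_integrable integrable_site_average)
  also have "\<dots> = (\<integral>w. site_average p x F w \<partial>?B) * (\<integral>w. f w \<partial>?B)"
    using insert by (intro insert.IH depends_on_site_average) auto
  also have "(\<integral>w. site_average p x F w \<partial>?B) = (\<integral>w. F w \<partial>?B)"
    by (rule integral_site_average[OF integrable_local[OF fin insert.prems(1)]])
  finally show ?case .
qed

lemma integral_mult_local:
  fixes F G :: "config \<Rightarrow> real"
  assumes "finite S" "depends_on S F" "finite T" "depends_on T G" "S \<inter> T = {}" "0 \<le> p" "p \<le> 1"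
  shows "(\<integral>w. F w * G w \<partial>bernoulli_product p) =
    (\<integral>w. F w \<partial>bernoulli_product p) * (\<integral>w. G w \<partial>bernoulli_product p)"
proof (rule integral_mult_invariant[of S])
  show "AE w in bernoulli_product p. G (w(x := False)) = G w" if "x \<in> S" for x
    using that assms by (intro AE_I2 depends_on_upd[of T]) auto
qed (use assms in \<open>auto intro: integrable_local\<close>)

lemma integral_site:
  assumes "0 \<le> p" "p \<le> 1"
  shows "(\<integral>w. of_bool (w x) \<partial>bernoulli_product p) = p"
proof -
  have "depends_on {x} (\<lambda>w. of_bool (w x) :: real)" by (simp add: depends_on_def)
  then have "integrable (bernoulli_product p) (\<lambda>w. of_bool (w x) :: real)"
    by (intro integrable_local[of "{x}"]) auto
  from integral_site_average[OF this, of x] show ?thesis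
    using assms by (simp add: site_average_eq bernoulli.prob_space)
qed

section \<open>The generator and invariance of the kernel\<close>

lemma site_average_notin: "depends_on S f \<Longrightarrow> x \<notin> S \<Longrightarrow> site_average p x f w = f w"
  by (simp add: site_average_def depends_on_upd)

lemma finite_children [simp]: "finite (children x)"
  by (simp add: children_def full_SetCompr_eq)

lemma ad_rate_eq: "ad_rate x w = of_bool (\<forall>b. \<not> w (b # x))"
  by (auto simp: ad_rate_def children_def)

lemma ad_rate_nonneg: "0 \<le> ad_rate x w"
  by (simp add: ad_rate_eq)

lemma ad_rate_upd [simp]: "ad_rate x (w(x := b)) = ad_rate x w"
  by (simp add: ad_rate_eq)

lemma depends_on_ad_rate: "depends_on (children x) (ad_rate x)"
  by (auto simp: depends_on_def ad_rate_def)

lemma ad_generator_eq_sum: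
  assumes "finite S" "depends_on S f"
  shows "ad_generator p f w = (\<Sum>x\<in>S. ad_rate x w * (site_average p x f w - f w))"
proof -
  have "ad_generator p f w = infsum (\<lambda>x. ad_rate x w * (site_average p x f w - f w)) S"
    unfolding ad_generator_def
    by (rule infsum_cong_neutral) (auto simp: site_average_notin[OF assms(2)])
  then show ?thesis using assms(1) by simp
qed

lemma depends_on_generator_term:
  assumes "depends_on S f"
  shows "depends_on (S \<union> children x) (\<lambda>w. ad_rate x w * (site_average p x f w - f w))"
proof -
  have "depends_on S (site_average p x f)"
    by (rule depends_on_site_average) (rule depends_on_mono[OF assms subset_insertI])
  then show ?thesis
    by (intro depends_on_comp2[where h = "(*)"] depends_on_comp2[where h = "(-)"])
      (auto intro: depends_on_mono[OF assms] depends_on_mono[OF depends_on_ad_rate]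
        elim: depends_on_mono)
qed

lemma depends_on_ad_generator:
  assumes "finite S" "depends_on S f"
  shows "depends_on (S \<union> (\<Union>x\<in>S. children x)) (ad_generator p f)"
proof -
  have "depends_on (S \<union> (\<Union>x\<in>S. children x))
      (\<lambda>w. ad_rate x w * (site_average p x f w - f w))" if "x \<in> S" for x
    by (rule depends_on_mono[OF depends_on_generator_term[OF assms(2)]]) (use that in auto)
  then show ?thesis
    unfolding depends_on_def ad_generator_eq_sum[OF assms]
    by (intro allI impI sum.cong refl) blast
qed

text \<open>The rate of x does not read the value at x. After averaging over that value, both
  integrands become the rate times p (1 - p) times the squared difference of F between the values 1
  and 0 at x.\<close>

lemma integral_ad_rate_upd_eq:
  fixes F :: "config \<Rightarrow> real"
  assumes "0 \<le> p" "p \<le> 1" "finite S" "depends_on S F"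
  shows "(1 - p) * (\<integral>w. ad_rate x w * (F (w(x := False)) - F w)\<^sup>2 \<partial>bernoulli_product p) =
    (\<integral>w. - F w * (ad_rate x w * (site_average p x F w - F w)) \<partial>bernoulli_product p)"
proof -
  let ?T = "insert x (S \<union> children x)"
  have F: "depends_on ?T F" by (rule depends_on_mono[OF assms(4)]) auto
  have dep: "depends_on ?T (\<lambda>w. F (w(x := b)))" for b
    unfolding depends_on_def by (auto intro!: depends_on_cong[OF F])
  have c: "depends_on ?T (ad_rate x)" by (rule depends_on_mono[OF depends_on_ad_rate]) auto
  have 1: "integrable (bernoulli_product p) (\<lambda>w. ad_rate x w * (F (w(x := False)) - F w)\<^sup>2)"
    by (rule integrable_local[of ?T], simp add: assms)
      (intro depends_on_comp2[where h = "(*)"] depends_on_comp[where h = "\<lambda>a. a\<^sup>2"]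
        depends_on_comp2[where h = "(-)"] dep F c)
  have 2: "integrable (bernoulli_product p)
      (\<lambda>w. - F w * (ad_rate x w * (site_average p x F w - F w)))"
    by (rule integrable_local[of ?T], simp add: assms)
      (intro depends_on_comp2[where h = "\<lambda>a b. - a * b"] F
        depends_on_mono[OF depends_on_generator_term[OF F]], simp)
  show ?thesis
    unfolding integral_site_average[OF 1, of x, symmetric] integral_site_average[OF 2, of x, symmetric]
    by (subst Bochner_Integration.integral_mult_right_zero[symmetric],
        rule arg_cong[where f = "lebesgue_integral (bernoulli_product p)"])
      (simp add: fun_eq_iff site_average_eq[OF assms(1,2)] power2_eq_square algebra_simps)
qed

text \<open>
  The right-hand side is the Dirichlet form of \<open>F\<close>, which by reversibility is a sum of
  nonnegative contributions of the single sites.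
\<close>

lemma dirichlet_form_ge:
  fixes F :: "config \<Rightarrow> real"
  assumes "0 \<le> p" "p \<le> 1" "finite S" "depends_on S F"
  shows "(1 - p) * (\<integral>w. ad_rate x w * (F (w(x := False)) - F w)\<^sup>2 \<partial>bernoulli_product p) \<le>
    - (\<integral>w. F w * ad_generator p F w \<partial>bernoulli_product p)"
proof -
  let ?B = "bernoulli_product p" and ?T = "insert x S"
  let ?g = "\<lambda>y w. - F w * (ad_rate y w * (site_average p y F w - F w))"
  have T: "finite ?T" "depends_on ?T F" using assms by (auto intro: depends_on_mono)
  have int: "integrable ?B (?g y)" for y
    by (rule integrable_local[of "?T \<union> children y"], simp add: assms)
      (intro depends_on_comp2[where h = "\<lambda>a b. - a * b"] depends_on_generator_term
        T(2) depends_on_mono[OF T(2)], blast)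
  have nonneg: "0 \<le> (\<integral>w. ?g y w \<partial>?B)" for y
    unfolding integral_ad_rate_upd_eq[OF assms, symmetric]
    using assms(2) by (intro mult_nonneg_nonneg integral_nonneg_AE) (auto simp: ad_rate_nonneg)
  have "(\<integral>w. ?g x w \<partial>?B) \<le> (\<Sum>y\<in>?T. \<integral>w. ?g y w \<partial>?B)"
    using T(1) nonneg by (intro member_le_sum) auto
  also have "\<dots> = (\<integral>w. (\<Sum>y\<in>?T. ?g y w) \<partial>?B)" using int by simp
  also have "\<dots> = (\<integral>w. - (F w * ad_generator p F w) \<partial>?B)"
    by (rule Bochner_Integration.integral_cong)
      (simp_all only: ad_generator_eq_sum[OF T] sum_distrib_left sum_negf mult_minus_left)
  finally show ?thesis by (simp add: integral_ad_rate_upd_eq[OF assms])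
qed

text \<open>The average over x has \<open>(1 - p) * h (w(x := False))\<close> as one of its two
  nonnegative terms. So emptying x costs at most a factor 1 / (1 - p), and L2 approximation carries
  over to the emptied configuration.\<close>

lemma integral_upd_False_le:
  fixes h :: "config \<Rightarrow> real"
  assumes "0 \<le> p" "p < 1" "integrable (bernoulli_product p) h" "\<And>w. 0 \<le> h w"
  shows "integrable (bernoulli_product p) (\<lambda>w. h (w(x := False)))"
    and "(1 - p) * (\<integral>w. h (w(x := False)) \<partial>bernoulli_product p) \<le> (\<integral>w. h w \<partial>bernoulli_product p)"
proof -
  show int: "integrable (bernoulli_product p) (\<lambda>w. h (w(x := False)))"
    using assms by (intro integrable_resample[OF assms(3)]) (auto simp: set_pmf_iff)
  have "(\<integral>w. (1 - p) * h (w(x := False)) \<partial>bernoulli_product p) \<le>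
      (\<integral>w. site_average p x h w \<partial>bernoulli_product p)"
    using assms int by (intro integral_mono integrable_site_average) (auto simp: site_average_eq)
  then show "(1 - p) * (\<integral>w. h (w(x := False)) \<partial>bernoulli_product p) \<le>
      (\<integral>w. h w \<partial>bernoulli_product p)"
    by (simp add: integral_site_average[OF assms(3)])
qed

lemma integrable_local_diff_square:
  assumes "finite S" "depends_on S F" "in_L2 p f"
  shows "integrable (bernoulli_product p) (\<lambda>w. (F w - f w)\<^sup>2)"
proof -
  have f: "f \<in> borel_measurable (bernoulli_product p)" "integrable (bernoulli_product p) (\<lambda>w. (f w)\<^sup>2)"
    using assms(3) by (auto simp: in_L2_def)
  have "integrable (bernoulli_product p) (\<lambda>w. F w * f w)"
    by (rule integrable_local_mult[OF assms(1,2) bernoulli.square_integrable_imp_integrable[OF f]])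
  moreover have "integrable (bernoulli_product p) (\<lambda>w. F w * F w)"
    by (rule integrable_local_mult[OF assms(1,2) integrable_local[OF assms(1,2)]])
  ultimately have "integrable (bernoulli_product p) (\<lambda>w. F w * F w - 2 * (F w * f w) + (f w)\<^sup>2)"
    using f(2) by (intro Bochner_Integration.integrable_add Bochner_Integration.integrable_diff
        integrable_mult_right)
  then show ?thesis by (simp add: power2_eq_square algebra_simps)
qed

lemma square_sum3_le: "(a + b + c)\<^sup>2 \<le> 3 * (a\<^sup>2 + b\<^sup>2 + c\<^sup>2)" for a b c :: real
proof -
  have "3 * (a\<^sup>2 + b\<^sup>2 + c\<^sup>2) - (a + b + c)\<^sup>2 = (a - b)\<^sup>2 + (b - c)\<^sup>2 + (c - a)\<^sup>2"
    by (simp add: power2_eq_square algebra_simps)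
  then show ?thesis by (smt (verit) zero_le_power2)
qed

text \<open>An element of the kernel is only an L2 limit of local functions, so the Dirichlet form
  has to be reached by approximation. Up to a constant, Q is the contribution of x to the form of f;
  it is bounded through \<open>F n\<close> and shown to be 0. As the rate is 1 wherever a move at x
  is legal, f does not change there.\<close>

lemma kernel_invariant:
  assumes p: "0 \<le> p" "p < 1" and graph: "ad_L2_graph p f (\<lambda>w. 0 * f w)"
  shows "AE w in bernoulli_product p. (\<forall>b. \<not> w (b # x)) \<longrightarrow> f (w(x := False)) = f w"
proof -
  let ?B = "bernoulli_product p"
  obtain F where F: "\<And>n. local_function (F n)"
    and D0: "(\<lambda>n. \<integral>w. (F n w - f w)\<^sup>2 \<partial>?B) \<longlonglongrightarrow> 0"
    and E0: "(\<lambda>n. \<integral>w. (ad_generator p (F n) w)\<^sup>2 \<partial>?B) \<longlonglongrightarrow> 0"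
    and L2: "in_L2 p f"
    using graph by (auto simp: ad_L2_graph_def)
  define D E where "D n = (\<integral>w. (F n w - f w)\<^sup>2 \<partial>?B)"
    and "E n = (\<integral>w. (ad_generator p (F n) w)\<^sup>2 \<partial>?B)" for n
  define I where "I = (\<integral>w. (f w)\<^sup>2 \<partial>?B)"
  define Q where "Q = (\<integral>w. ad_rate x w * (f (w(x := False)) - f w)\<^sup>2 \<partial>?B)"
  have meas [measurable]: "f \<in> borel_measurable ?B" and f2: "integrable ?B (\<lambda>w. (f w)\<^sup>2)"
    using L2 by (auto simp: in_L2_def)
  have f0: "integrable ?B (\<lambda>w. (f (w(x := False)))\<^sup>2)"
    by (rule integral_upd_False_le(1)[OF p f2]) simp
  have fi: "integrable ?B f" by (rule bernoulli.square_integrable_imp_integrable[OF meas f2])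
  have "integrable ?B (\<lambda>w. f (w(x := False)))"
    using p by (intro integrable_resample[OF fi]) (auto simp: set_pmf_iff)
  then have [measurable]: "(\<lambda>w. f (w(x := False))) \<in> borel_measurable ?B" by simp
  have [measurable]: "ad_rate x \<in> borel_measurable ?B"
    by (rule measurable_local[OF _ depends_on_ad_rate]) simp
  have diff: "integrable ?B (\<lambda>w. (f (w(x := False)) - f w)\<^sup>2)"
  proof (rule Bochner_Integration.integrable_bound)
    show "integrable ?B (\<lambda>w. 2 * (f (w(x := False)))\<^sup>2 + 2 * (f w)\<^sup>2)" using f0 f2 by simp
    show "AE w in ?B. norm ((f (w(x := False)) - f w)\<^sup>2) \<le> norm (2 * (f (w(x := False)))\<^sup>2 + 2 * (f w)\<^sup>2)"
      by (rule AE_I2) (smt (verit) real_norm_def sum_squares_bound power2_diff power2_sum zero_le_power2)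
  qed simp
  have intQ: "integrable ?B (\<lambda>w. ad_rate x w * (f (w(x := False)) - f w)\<^sup>2)"
    by (rule integrable_local_mult[OF _ depends_on_ad_rate diff]) simp
  have bound: "Q \<le> 3 * (D n / (1 - p) + (\<epsilon> * (2 * D n + 2 * I) + E n / \<epsilon>) / (1 - p) + D n)"
    if "\<epsilon> > 0" for n \<epsilon>
  proof -
    obtain S where S: "finite S" "depends_on S (F n)" using F[of n] by (auto simp: local_function_iff)
    define G where "G = F n"
    define T where "T = S \<union> (\<Union>x\<in>S. children x)"
    have G: "depends_on S G" using S by (simp add: G_def)
    have T: "finite T" "depends_on T (ad_generator p G)" "depends_on T G"
      using S(1) depends_on_ad_generator[OF S(1) G] depends_on_mono[OF G, of T]
      by (auto simp: T_def)
    have d: "integrable ?B (\<lambda>w. (G w - f w)\<^sup>2)"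
      by (rule integrable_local_diff_square[OF S(1) G L2])
    have d0: "integrable ?B (\<lambda>w. (G (w(x := False)) - f (w(x := False)))\<^sup>2)"
      by (rule integral_upd_False_le(1)[OF p d]) simp
    have dG: "depends_on (insert x S \<union> children x) (\<lambda>w. ad_rate x w * (G (w(x := False)) - G w)\<^sup>2)"
      unfolding depends_on_def ad_rate_eq
      by (auto simp: children_def intro!: arg_cong2[where f = "(-)"] arg_cong[where f = "\<lambda>a. a\<^sup>2"]
          depends_on_cong[OF G])
    have g: "integrable ?B (\<lambda>w. ad_rate x w * (G (w(x := False)) - G w)\<^sup>2)"
      by (rule integrable_local[OF _ dG]) (simp add: S)
    \<comment> \<open>Insert G between the two values of f. The rate, at most 1, is discarded on the
      two error terms but kept on the jump of G, which the Dirichlet form controls only where a move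
      is legal.\<close>
    have "Q \<le> (\<integral>w. 3 * ((G (w(x := False)) - f (w(x := False)))\<^sup>2 +
        ad_rate x w * (G (w(x := False)) - G w)\<^sup>2 + (G w - f w)\<^sup>2) \<partial>?B)"
      unfolding Q_def
    proof (intro integral_mono intQ)
      show "integrable ?B (\<lambda>w. 3 * ((G (w(x := False)) - f (w(x := False)))\<^sup>2 +
        ad_rate x w * (G (w(x := False)) - G w)\<^sup>2 + (G w - f w)\<^sup>2))"
        using d d0 g by simp
      fix w
      have "ad_rate x w * (f (w(x := False)) - f w)\<^sup>2 \<le>
        ad_rate x w * (3 * ((f (w(x := False)) - G (w(x := False)))\<^sup>2 +
         (G (w(x := False)) - G w)\<^sup>2 + (G w - f w)\<^sup>2))"
        using square_sum3_le[of "f (w(x := False)) - G (w(x := False))" "G (w(x := False)) - G w" "G w - f w"]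
        by (intro mult_left_mono ad_rate_nonneg) simp
      also have "\<dots> \<le> 3 * ((G (w(x := False)) - f (w(x := False)))\<^sup>2 +
        ad_rate x w * (G (w(x := False)) - G w)\<^sup>2 + (G w - f w)\<^sup>2)"
        by (simp add: ad_rate_eq power2_commute)
      finally show "ad_rate x w * (f (w(x := False)) - f w)\<^sup>2 \<le>
        3 * ((G (w(x := False)) - f (w(x := False)))\<^sup>2 +
        ad_rate x w * (G (w(x := False)) - G w)\<^sup>2 + (G w - f w)\<^sup>2)" .
    qed
    also have "\<dots> = 3 * ((\<integral>w. (G (w(x := False)) - f (w(x := False)))\<^sup>2 \<partial>?B) +
        (\<integral>w. ad_rate x w * (G (w(x := False)) - G w)\<^sup>2 \<partial>?B) + (\<integral>w. (G w - f w)\<^sup>2 \<partial>?B))"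
      using d d0 g by simp
    finally have 1: "Q \<le> 3 * ((\<integral>w. (G (w(x := False)) - f (w(x := False)))\<^sup>2 \<partial>?B) +
        (\<integral>w. ad_rate x w * (G (w(x := False)) - G w)\<^sup>2 \<partial>?B) + D n)"
      by (simp add: D_def G_def)
    have 2: "(\<integral>w. (G (w(x := False)) - f (w(x := False)))\<^sup>2 \<partial>?B) \<le> D n / (1 - p)"
      using integral_upd_False_le(2)[OF p d, of x] p by (simp add: D_def G_def field_simps)
    have iGG: "integrable ?B (\<lambda>w. (G w)\<^sup>2)"
      by (rule integrable_local[OF S(1)]) (intro depends_on_comp[where h = "\<lambda>a. a\<^sup>2"] G)
    have iLL: "integrable ?B (\<lambda>w. (ad_generator p G w)\<^sup>2)"
      by (rule integrable_local[OF T(1)]) (intro depends_on_comp[where h = "\<lambda>a. a\<^sup>2"] T)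
    have iGL: "integrable ?B (\<lambda>w. G w * ad_generator p G w)"
      by (rule integrable_local[OF T(1)]) (intro depends_on_comp2[where h = "(*)"] T)
    have "- (\<integral>w. G w * ad_generator p G w \<partial>?B) = (\<integral>w. - (G w * ad_generator p G w) \<partial>?B)" by simp
    \<comment> \<open>Young's inequality with weight \<epsilon>: the norm of G is merely bounded in
      n, while that of its generator tends to 0, so the small weight goes on G.\<close>
    also have "\<dots> \<le> (\<integral>w. \<epsilon> * (2 * (G w - f w)\<^sup>2 + 2 * (f w)\<^sup>2) + (ad_generator p G w)\<^sup>2 / \<epsilon> \<partial>?B)"
    proof (rule integral_mono)
      fix w
      let ?a = "G w" and ?b = "ad_generator p G w"
      have "0 \<le> (\<epsilon> * ?a + ?b)\<^sup>2 / \<epsilon>" using that by simp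
      also have "\<dots> = \<epsilon> * ?a\<^sup>2 + 2 * (?a * ?b) + ?b\<^sup>2 / \<epsilon>"
        using that by (simp add: power2_eq_square field_simps)
      finally have "- 2 * (?a * ?b) \<le> \<epsilon> * ?a\<^sup>2 + ?b\<^sup>2 / \<epsilon>" by simp
      moreover have "0 \<le> \<epsilon> * ?a\<^sup>2 + ?b\<^sup>2 / \<epsilon>" using that by simp
      ultimately have "- (?a * ?b) \<le> \<epsilon> * ?a\<^sup>2 + ?b\<^sup>2 / \<epsilon>" by linarith
      moreover have "?a\<^sup>2 \<le> 2 * (?a - f w)\<^sup>2 + 2 * (f w)\<^sup>2"
      proof -
        have "2 * (?a - f w)\<^sup>2 + 2 * (f w)\<^sup>2 - ?a\<^sup>2 = (?a - 2 * f w)\<^sup>2"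
          by (simp add: power2_eq_square algebra_simps)
        then show ?thesis by (smt (verit) zero_le_power2)
      qed
      then have "\<epsilon> * ?a\<^sup>2 \<le> \<epsilon> * (2 * (?a - f w)\<^sup>2 + 2 * (f w)\<^sup>2)"
        using that by (intro mult_left_mono) auto
      ultimately show "- (?a * ?b) \<le> \<epsilon> * (2 * (?a - f w)\<^sup>2 + 2 * (f w)\<^sup>2) + ?b\<^sup>2 / \<epsilon>" by linarith
    qed (use d f2 iLL iGL in simp_all)
    also have "\<dots> = \<epsilon> * (2 * D n + 2 * I) + E n / \<epsilon>"
      using d f2 iLL by (simp add: D_def E_def I_def G_def)
    finally have "(1 - p) * (\<integral>w. ad_rate x w * (G (w(x := False)) - G w)\<^sup>2 \<partial>?B) \<le>
        \<epsilon> * (2 * D n + 2 * I) + E n / \<epsilon>"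
      using dirichlet_form_ge[of p S G x] p S(1) G by simp
    then have 3: "(\<integral>w. ad_rate x w * (G (w(x := False)) - G w)\<^sup>2 \<partial>?B) \<le>
        (\<epsilon> * (2 * D n + 2 * I) + E n / \<epsilon>) / (1 - p)"
      using p by (simp add: field_simps)
    show ?thesis
      by (rule order.trans[OF 1], rule mult_left_mono, intro add_mono 2 3) auto
  qed
  have "Q \<le> 0 + e" if e: "e > 0" for e
  proof -
    have "I \<ge> 0" unfolding I_def by (rule integral_nonneg_AE) simp
    \<comment> \<open>Once n tends to infinity only 6 \<delta> I survives, as the weight \<epsilon>
      = (1 - p) \<delta> cancels the factor 1 / (1 - p). Taking I + 1 avoids a division by
      0.\<close>
    obtain \<delta> where \<delta>: "\<delta> > 0" "\<delta> * (I + 1) = e / 6"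
      using e \<open>I \<ge> 0\<close> by (intro that[of "e / 6 / (I + 1)"] divide_pos_pos nonzero_eq_divide_eq[THEN iffD1, OF _ refl]) auto
    define \<epsilon> where "\<epsilon> = (1 - p) * \<delta>"
    have \<epsilon>: "\<epsilon> > 0" using p \<delta> by (simp add: \<epsilon>_def)
    have "(\<lambda>n. 3 * (D n / (1 - p) + (\<epsilon> * (2 * D n + 2 * I) + E n / \<epsilon>) / (1 - p) + D n)) \<longlonglongrightarrow>
        3 * (0 / (1 - p) + (\<epsilon> * (2 * 0 + 2 * I) + 0 / \<epsilon>) / (1 - p) + 0)"
      using D0 E0 \<epsilon> p unfolding D_def[symmetric] E_def[symmetric] by (intro tendsto_intros) auto
    then have "Q \<le> 3 * (0 / (1 - p) + (\<epsilon> * (2 * 0 + 2 * I) + 0 / \<epsilon>) / (1 - p) + 0)"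
      by (rule LIMSEQ_le_const) (use bound[OF \<epsilon>] in auto)
    also have "\<dots> = 6 * \<delta> * I" using p by (simp add: \<epsilon>_def)
    also have "\<dots> \<le> 6 * \<delta> * (I + 1)" using \<delta>(1) by (intro mult_left_mono) auto
    also have "\<dots> = e" by (simp only: mult.assoc \<delta>(2))
    finally show ?thesis by simp
  qed
  then have "Q \<le> 0" by (rule field_le_epsilon)
  moreover have "0 \<le> Q" unfolding Q_def by (rule integral_nonneg_AE) (simp add: ad_rate_nonneg)
  ultimately have "Q = 0" by simp
  then have "AE w in ?B. ad_rate x w * (f (w(x := False)) - f w)\<^sup>2 = 0"
    unfolding Q_def using intQ by (subst (asm) integral_nonneg_eq_0_iff_AE) (auto simp: ad_rate_nonneg)
  then show ?thesis by eventually_elim (auto simp: ad_rate_eq)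
qed

text \<open>By \<open>integral_mult_invariant\<close>, f - m is orthogonal to every local function,
  so by Pythagoras no \<open>F n\<close> is closer to f in L2 than the constant m. The graph
  supplies local functions converging to f, which forces the variance of f to be 0.\<close>

lemma invariant_imp_const:
  assumes p: "0 \<le> p" "p \<le> 1" and graph: "ad_L2_graph p f g"
    and inv: "\<And>x. AE w in bernoulli_product p. f (w(x := False)) = f w"
  shows "\<exists>m. AE w in bernoulli_product p. f w = m"
proof -
  let ?B = "bernoulli_product p"
  obtain F where F: "\<And>n. local_function (F n)"
    and D0: "(\<lambda>n. \<integral>w. (F n w - f w)\<^sup>2 \<partial>?B) \<longlonglongrightarrow> 0"
    and L2: "in_L2 p f"
    using graph by (auto simp: ad_L2_graph_def)
  have meas: "f \<in> borel_measurable ?B" and f2: "integrable ?B (\<lambda>w. (f w)\<^sup>2)"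
    using L2 by (auto simp: in_L2_def)
  have fi: "integrable ?B f" by (rule bernoulli.square_integrable_imp_integrable[OF meas f2])
  define m where "m = (\<integral>w. f w \<partial>?B)"
  have int: "integrable ?B (\<lambda>w. (f w - m)\<^sup>2)"
    using fi f2 by (simp add: power2_diff)
  have var: "(\<integral>w. (f w - m)\<^sup>2 \<partial>?B) \<le> (\<integral>w. (F n w - f w)\<^sup>2 \<partial>?B)" for n
  proof -
    obtain S where S: "finite S" "depends_on S (F n)" using F[of n] by (auto simp: local_function_iff)
    have i1: "integrable ?B (F n)" by (rule integrable_local[OF S])
    have i2: "integrable ?B (\<lambda>w. (F n w)\<^sup>2)"
      by (rule integrable_local[OF S(1)]) (intro depends_on_comp[where h = "\<lambda>a. a\<^sup>2"] S)
    have i3: "integrable ?B (\<lambda>w. F n w * f w)" by (rule integrable_local_mult[OF S fi])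
    have e3: "(\<integral>w. F n w * f w \<partial>?B) = (\<integral>w. F n w \<partial>?B) * m"
      unfolding m_def by (rule integral_mult_invariant[OF S p fi inv])
    have "(\<integral>w. (F n w - f w)\<^sup>2 \<partial>?B) = (\<integral>w. (F n w)\<^sup>2 + (f w)\<^sup>2 - 2 * (F n w * f w) \<partial>?B)"
      by (simp add: power2_diff mult.assoc)
    also have "\<dots> = (\<integral>w. (F n w)\<^sup>2 \<partial>?B) + (\<integral>w. (f w)\<^sup>2 \<partial>?B) - 2 * ((\<integral>w. F n w \<partial>?B) * m)"
      using i2 i3 f2 by (simp add: e3)
    finally have 1: "(\<integral>w. (F n w - f w)\<^sup>2 \<partial>?B) = \<dots>" .
    have "(\<integral>w. (f w - m)\<^sup>2 \<partial>?B) = (\<integral>w. (f w)\<^sup>2 + m\<^sup>2 - 2 * m * f w \<partial>?B)"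
      by (simp add: power2_diff mult_ac)
    also have "\<dots> = (\<integral>w. (f w)\<^sup>2 \<partial>?B) - m\<^sup>2"
      using f2 fi by (simp add: m_def[symmetric] power2_eq_square)
    finally have 2: "(\<integral>w. (f w - m)\<^sup>2 \<partial>?B) = \<dots>" .
    have "0 \<le> (\<integral>w. (F n w - m)\<^sup>2 \<partial>?B)" by (rule integral_nonneg_AE) simp
    also have "\<dots> = (\<integral>w. (F n w)\<^sup>2 + m\<^sup>2 - 2 * m * F n w \<partial>?B)"
      by (simp add: power2_diff mult_ac)
    also have "\<dots> = (\<integral>w. (F n w)\<^sup>2 \<partial>?B) + m\<^sup>2 - 2 * m * (\<integral>w. F n w \<partial>?B)"
      using i1 i2 by simp
    finally show ?thesis unfolding 1 2 by (simp add: power2_eq_square algebra_simps)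
  qed
  have "(\<integral>w. (f w - m)\<^sup>2 \<partial>?B) \<le> 0"
    by (rule LIMSEQ_le_const[OF D0]) (use var in blast)
  moreover have "0 \<le> (\<integral>w. (f w - m)\<^sup>2 \<partial>?B)" by (rule integral_nonneg_AE) simp
  ultimately have "(\<integral>w. (f w - m)\<^sup>2 \<partial>?B) = 0" by simp
  then have "AE w in ?B. (f w - m)\<^sup>2 = 0"
    using int by (subst (asm) integral_nonneg_eq_0_iff_AE) auto
  then have "AE w in ?B. f w = m" by eventually_elim simp
  then show ?thesis by blast
qed

section \<open>Extinction of the cluster below a vertex\<close>

text \<open>The depth counts edges: survival to depth n means a descending path of n + 1 ones
  starting at x. Truncation at a finite depth keeps the event local.\<close>

primrec extinct :: "nat \<Rightarrow> vertex \<Rightarrow> config \<Rightarrow> bool" where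
  "extinct 0 x w \<longleftrightarrow> \<not> w x"
| "extinct (Suc n) x w \<longleftrightarrow> (w x \<longrightarrow> extinct n (True # x) w \<and> extinct n (False # x) w)"

primrec sites :: "nat \<Rightarrow> vertex \<Rightarrow> vertex set" where
  "sites 0 x = {x}"
| "sites (Suc n) x = insert x (sites n (True # x) \<union> sites n (False # x))"

lemma finite_sites [simp]: "finite (sites n x)"
  by (induction n arbitrary: x) auto

text \<open>Choices are stored most recent first, so descending prepends. Siblings are distinct
  suffixes of equal length, whence the disjointness of their subtrees below.\<close>

lemma sites_suffix: "y \<in> sites n x \<Longrightarrow> \<exists>zs. y = zs @ x"
  by (induction n arbitrary: x) fastforce+

lemma notin_sites_Cons [simp]: "x \<notin> sites n (b # x)"
  using sites_suffix[of x n "b # x"] by auto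

lemma sites_disjoint: "sites n (True # x) \<inter> sites m (False # x) = {}"
  using sites_suffix[of _ n "True # x"] sites_suffix[of _ m "False # x"] by fastforce

lemma notin_sites_sibling [simp]: "True # x \<notin> sites n (False # x)" "False # x \<notin> sites n (True # x)"
  using sites_suffix[of _ n "False # x"] sites_suffix[of _ n "True # x"] by fastforce+

lemma sites_mono_Suc: "sites n x \<subseteq> sites (Suc n) x"
proof (induction n arbitrary: x)
  case (Suc n)
  show ?case using Suc[of "True # x"] Suc[of "False # x"]
    by (subst (1 2) sites.simps(2)) blast
qed simp

lemma depends_on_extinct: "depends_on (sites n x) (extinct n x)"
proof (induction n arbitrary: x)
  case (Suc n)
  show ?case unfolding depends_on_def
  proof (intro allI impI)
    fix w w' :: config assume eq: "\<forall>y\<in>sites (Suc n) x. w y = w' y"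
    have "extinct n (b # x) w = extinct n (b # x) w'" for b
      by (rule depends_on_cong[OF Suc]) (use eq in \<open>cases b; simp\<close>)
    then show "extinct (Suc n) x w = extinct (Suc n) x w'" using eq by simp
  qed
qed (simp add: depends_on_def)

lemma extinct_Suc: "extinct n x w \<Longrightarrow> extinct (Suc n) x w"
  by (induction n arbitrary: x) auto

section \<open>Extinction probabilities of the finite truncations\<close>

abbreviation u :: "nat \<Rightarrow> vertex \<Rightarrow> config \<Rightarrow> real" where
  "u n x w \<equiv> of_bool (extinct n x w)"

lemma depends_on_u: "depends_on (sites n x) (u n x)"
  by (intro depends_on_comp[where h = of_bool] depends_on_extinct)

lemma measurable_u: "u n x \<in> borel_measurable (bernoulli_product p)"
  by (rule measurable_local[OF finite_sites depends_on_u])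

text \<open>In this polynomial form the root and the two subtrees enter as separate factors, so
  means factorise and the generator acts by a product rule.\<close>

lemma u_Suc: "u (Suc n) x w = 1 - of_bool (w x) + of_bool (w x) * (u n (True # x) w * u n (False # x) w)"
  by auto

text \<open>Iterates, started from 0 and shifted by one, of q \<mapsto> 1 - p + p q^2, the
  generating function of a branching process with two offspring with probability p and none
  otherwise.\<close>

primrec extinction_prob :: "real \<Rightarrow> nat \<Rightarrow> real" where
  "extinction_prob p 0 = 1 - p"
| "extinction_prob p (Suc n) = 1 - p + p * (extinction_prob p n)\<^sup>2"

lemma integral_site_mult:
  assumes p: "0 \<le> p" "p \<le> 1"
    and "depends_on (sites m (True # x)) F" "depends_on (sites n (False # x)) G"
  shows "(\<integral>w. of_bool (w x) * (F w * G w) \<partial>bernoulli_product p) =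
    p * ((\<integral>w. F w \<partial>bernoulli_product p) * (\<integral>w. G w \<partial>bernoulli_product p))"
proof -
  have "(\<integral>w. of_bool (w x) * (F w * G w) \<partial>bernoulli_product p) =
      (\<integral>w. of_bool (w x) \<partial>bernoulli_product p) * (\<integral>w. F w * G w \<partial>bernoulli_product p)"
    by (rule integral_mult_local[of "{x}" _ "sites m (True # x) \<union> sites n (False # x)"])
      (use p assms in \<open>auto simp: depends_on_def intro!: arg_cong2[where f = "(*)"]\<close>)
  also have "(\<integral>w. F w * G w \<partial>bernoulli_product p) =
      (\<integral>w. F w \<partial>bernoulli_product p) * (\<integral>w. G w \<partial>bernoulli_product p)"
    by (rule integral_mult_local[OF finite_sites assms(3) finite_sites assms(4) sites_disjoint p])
  finally show ?thesis by (simp add: integral_site[OF p])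
qed

lemma integrable_site: "integrable (bernoulli_product p) (\<lambda>w. of_bool (w x) :: real)"
  by (rule integrable_local[of "{x}"]) (auto simp: depends_on_def)

lemma integrable_u: "integrable (bernoulli_product p) (u n x)"
  by (rule integrable_local[OF finite_sites depends_on_u])

lemma integral_u:
  assumes p: "0 \<le> p" "p \<le> 1"
  shows "(\<integral>w. u n x w \<partial>bernoulli_product p) = extinction_prob p n"
proof (induction n arbitrary: x)
  case 0
  have "(\<integral>w. u 0 x w \<partial>bernoulli_product p) = (\<integral>w. 1 - of_bool (w x) \<partial>bernoulli_product p)"
    by (simp add: of_bool_not_iff)
  then show ?case by (simp add: integrable_site integral_site[OF p])
next
  case (Suc n)
  have "integrable (bernoulli_product p) (\<lambda>w. of_bool (w x) * (u n (True # x) w * u n (False # x) w))"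
    by (rule integrable_local[of "sites (Suc n) x"]) (simp,
      intro depends_on_comp2[where h = "(*)"] depends_on_mono[OF depends_on_u], auto simp: depends_on_def)
  then show ?case
    unfolding u_Suc
    by (simp add: integrable_site integral_site[OF p] integral_site_mult[OF p depends_on_u depends_on_u]
        Suc power2_eq_square del: extinct.simps)
qed

lemma extinction_prob_bounds: "0 \<le> p \<Longrightarrow> p \<le> 1 \<Longrightarrow> 0 \<le> extinction_prob p n \<and> extinction_prob p n \<le> 1"
proof (induction n)
  case (Suc n)
  then have "p * (extinction_prob p n)\<^sup>2 \<le> p * 1" by (intro mult_left_mono power_le_one) auto
  with Suc show ?case by simp
qed simp

text \<open>The recursion increases in q and decreases in p, so the worst case is p = 1/2, for which
  1 - 2 / (n + 2) is a subsolution.\<close>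

lemma extinction_prob_subcritical:
  assumes "0 \<le> p" "p \<le> 1/2"
  shows "1 - 2 / (real n + 2) \<le> extinction_prob p n"
proof (induction n)
  case 0
  then show ?case using assms by simp
next
  case (Suc n)
  let ?q = "extinction_prob p n"
  have q: "0 \<le> ?q" "?q \<le> 1" using extinction_prob_bounds[of p n] assms by auto
  define k where "k = real n + 2"
  have k: "k > 0" by (simp add: k_def)
  have "1/2 + 1/2 * (1 - 2 / k)\<^sup>2 - (1 - 2 / (k + 1)) = 2 / (k\<^sup>2 * (k + 1))"
    using k by (simp add: divide_simps power2_eq_square) (simp add: algebra_simps)
  also have "\<dots> \<ge> 0" using k by simp
  finally have "1 - 2 / (real (Suc n) + 2) \<le> 1/2 + 1/2 * (1 - 2 / (real n + 2))\<^sup>2"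
    by (simp add: k_def add_ac)
  also have "\<dots> \<le> 1/2 + 1/2 * ?q\<^sup>2"
    using Suc by (intro add_left_mono mult_left_mono power_mono) (auto simp: field_simps)
  also have "\<dots> = 1 - 1/2 * (1 - ?q\<^sup>2)" by (simp add: field_simps)
  also have "\<dots> \<le> 1 - p * (1 - ?q\<^sup>2)"
    using assms q by (intro diff_left_mono mult_right_mono) (auto simp: power_le_one)
  finally show ?case by (simp add: algebra_simps)
qed

lemma extinction_prob_subcritical_LIMSEQ:
  assumes "0 \<le> p" "p \<le> 1/2"
  shows "extinction_prob p \<longlonglongrightarrow> 1"
proof (rule tendsto_sandwich)
  show "(\<lambda>n. 1 - 2 / (real n + 2)) \<longlonglongrightarrow> 1" by real_asymp
  show "\<forall>\<^sub>F n in sequentially. 1 - 2 / (real n + 2) \<le> extinction_prob p n"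
    using extinction_prob_subcritical[OF assms] by simp
  show "\<forall>\<^sub>F n in sequentially. extinction_prob p n \<le> 1"
    using extinction_prob_bounds[of p] assms by auto
qed simp

text \<open>(1 - p) / p is a fixed point of the recursion and the iteration starts below it.
  Multiplied by p, the induction step amounts to squaring p q \<le> 1 - p.\<close>

lemma extinction_prob_supercritical:
  assumes "1/2 \<le> p" "p \<le> 1"
  shows "p * extinction_prob p n \<le> 1 - p"
proof (induction n)
  case 0
  then show ?case using assms by (simp add: mult_left_le_one_le)
next
  case (Suc n)
  have "0 \<le> p * extinction_prob p n" using extinction_prob_bounds[of p n] assms by auto
  then have "(p * extinction_prob p n)\<^sup>2 \<le> (1 - p)\<^sup>2" using Suc by (intro power_mono) auto
  then show ?case by (simp add: power2_eq_square algebra_simps)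
qed

lemma AE_extinct_subcritical:
  assumes p: "0 \<le> p" "p \<le> 1/2"
  shows "AE w in bernoulli_product p. \<exists>n. extinct n x w"
proof -
  let ?B = "bernoulli_product p"
  have [measurable]: "Measurable.pred ?B (extinct n x)" for n
    using measurable_sets[OF measurable_u[of n x p], of "{1}"] by (simp add: pred_def vimage_def)
  have "(\<integral>w. of_bool (\<forall>n. \<not> extinct n x w) \<partial>?B) \<le> (1 - extinction_prob p n :: real)" for n
  proof -
    have "(\<integral>w. of_bool (\<forall>n. \<not> extinct n x w) \<partial>?B) \<le> (\<integral>w. 1 - u n x w \<partial>?B)"
      by (intro integral_mono bernoulli.integrable_const_bound[of _ 1]) (auto simp: integrable_u)
    also have "\<dots> = 1 - extinction_prob p n" using p by (simp add: integrable_u integral_u)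
    finally show ?thesis .
  qed
  moreover have "(\<lambda>n. 1 - extinction_prob p n) \<longlonglongrightarrow> 1 - 1"
    by (intro tendsto_intros extinction_prob_subcritical_LIMSEQ p)
  ultimately have "(\<integral>w. of_bool (\<forall>n. \<not> extinct n x w) \<partial>?B) \<le> (0::real)"
    by (intro LIMSEQ_le_const[of "\<lambda>n. 1 - extinction_prob p n"]) auto
  moreover have "0 \<le> (\<integral>w. of_bool (\<forall>n. \<not> extinct n x w) \<partial>?B :: real)"
    by (rule integral_nonneg_AE) simp
  moreover have "integrable ?B (\<lambda>w. of_bool (\<forall>n. \<not> extinct n x w) :: real)"
    by (intro bernoulli.integrable_const_bound[of _ 1]) auto
  ultimately have "AE w in ?B. of_bool (\<forall>n. \<not> extinct n x w) = (0::real)"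
    by (subst integral_nonneg_eq_0_iff_AE[symmetric]) auto
  then show ?thesis by eventually_elim auto
qed

text \<open>
  If the cluster below \<open>x\<close> is finite, the value at \<open>x\<close> can be set to 0 by legal moves only: first
  empty the two children, then \<open>x\<close>, and undo the moves at the children.
\<close>

lemma invariant_on_extinct:
  assumes p: "0 \<le> p" "p < 1"
    and inv: "\<And>x. AE w in bernoulli_product p. (\<forall>b. \<not> w (b # x)) \<longrightarrow> f (w(x := False)) = f w"
  shows "AE w in bernoulli_product p. extinct n x w \<longrightarrow> f (w(x := False)) = f w"
proof (induction n arbitrary: x)
  case 0
  show ?case by (rule AE_I2) (auto simp: fun_upd_idem)
next
  case (Suc n)
  let ?B = "bernoulli_product p" and ?y = "True # x" and ?z = "False # x"
  note upd = AE_upd_False[OF _ p]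
  have indep: "extinct n (b # x) (w(v := c)) = extinct n (b # x) w"
    if "v \<notin> sites n (b # x)" for b v c w
    using that by (rule depends_on_upd[OF depends_on_extinct])
  \<comment> \<open>With superscripts naming the emptied sites, the chain is f(w) = f(w^y) = f(w^yz)
    = f(w^xyz) = f(w^xy) = f(w^x). Each link is an almost sure statement at a modified
    configuration, hence the pullbacks by \<open>upd\<close>.\<close>
  have "AE w in ?B. extinct n ?y w \<longrightarrow> f (w(?y := False)) = f w" by (rule Suc)
  moreover have "AE w in ?B. extinct n ?y (w(x := False)) \<longrightarrow>
      f (w(x := False, ?y := False)) = f (w(x := False))"
    by (rule upd[OF Suc])
  moreover have "AE w in ?B. extinct n ?z (w(?y := False)) \<longrightarrow>
      f (w(?y := False, ?z := False)) = f (w(?y := False))"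
    by (rule upd[OF Suc])
  moreover have "AE w in ?B. extinct n ?z (w(x := False, ?y := False)) \<longrightarrow>
      f (w(x := False, ?y := False, ?z := False)) = f (w(x := False, ?y := False))"
    by (rule upd[OF upd[OF Suc]])
  moreover have "AE w in ?B. (\<forall>b. \<not> (w(?y := False, ?z := False)) (b # x)) \<longrightarrow>
      f (w(?y := False, ?z := False, x := False)) = f (w(?y := False, ?z := False))"
    by (rule upd[OF upd[OF inv]])
  ultimately show ?case
  proof eventually_elim
    case (elim w)
    have twist: "w(?y := False, ?z := False, x := False) = w(x := False, ?y := False, ?z := False)"
      by (auto simp: fun_eq_iff)
    have legal: "\<forall>b. \<not> (w(?y := False, ?z := False)) (b # x)" by auto
    show ?case
    proof
      assume ext: "extinct (Suc n) x w"
      show "f (w(x := False)) = f w"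
      proof (cases "w x")
        case False
        then show ?thesis by (simp add: fun_upd_idem)
      next
        case True
        with ext have "extinct n ?y w" "extinct n ?z w" by auto
        then show ?thesis using elim legal by (simp add: indep twist)
      qed
    qed
  qed
qed

lemma kernel_const_subcritical:
  assumes p: "0 \<le> p" "p < 1/2" and graph: "ad_L2_graph p f (\<lambda>w. 0 * f w)"
  shows "\<exists>m. AE w in bernoulli_product p. f w = m"
proof (rule invariant_imp_const[OF _ _ graph])
  fix x
  have "AE w in bernoulli_product p. \<forall>n. extinct n x w \<longrightarrow> f (w(x := False)) = f w"
    unfolding AE_all_countable using p by (intro allI invariant_on_extinct kernel_invariant[OF _ _ graph]) auto
  with AE_extinct_subcritical[of p x] p
  show "AE w in bernoulli_product p. f (w(x := False)) = f w"
    by (auto elim: eventually_elim2)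
qed (use p in auto)

lemma ad_generator_const: "ad_generator p (\<lambda>_. a) w = 0"
  by (simp add: ad_generator_eq_sum[of "{}"] depends_on_const)

lemma ad_L2_graph_const: "ad_L2_graph p (\<lambda>_. a) (\<lambda>_. 0)"
  unfolding ad_L2_graph_def in_L2_def
  by (auto intro!: exI[of _ "\<lambda>_ _. a"] simp: ad_generator_const local_function_def)

lemma simple_eigenvalue_subcritical:
  assumes "0 \<le> p" "p < 1/2"
  shows "ad_simple_eigenvalue p 0"
  unfolding ad_simple_eigenvalue_def
  using kernel_const_subcritical[OF assms] ad_L2_graph_const[of p 1]
  by (intro exI[of _ "\<lambda>_. 1"]) auto

section \<open>The threshold\<close>

lemma extinct_if_closed: "\<not> w x \<Longrightarrow> extinct n x w"
  by (cases n) auto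

lemma children_sites: "v \<in> sites n x \<Longrightarrow> children v \<subseteq> sites (Suc n) x"
proof (induction n arbitrary: x)
  case 0
  then show ?case by (auto simp: children_def)
next
  case (Suc n)
  have sub: "sites (Suc n) (b # x) \<subseteq> sites (Suc (Suc n)) x" for b
    by (cases b) (simp_all only: sites.simps(2)[of "Suc n" x], blast+)
  consider "v = x" | b where "v \<in> sites n (b # x)" using Suc.prems by auto
  then show ?case
  proof cases
    case 1
    have "b # x \<in> sites (Suc n) (b # x)" for b by simp
    with sub 1 show ?thesis by (auto simp: children_def simp del: sites.simps)
  next
    case 2
    with Suc.IH sub show ?thesis by blast
  qed
qed

lemma depends_on_generator_u: "depends_on (sites (Suc n) x) (ad_generator p (u n x))"
proof (rule depends_on_mono[OF depends_on_ad_generator[OF finite_sites depends_on_u]])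
  show "sites n x \<union> (\<Union>v\<in>sites n x. children v) \<subseteq> sites (Suc n) x"
    using children_sites[of _ n x] sites_mono_Suc[of n x] by blast
qed

lemma ad_generator_u_0:
  assumes "0 \<le> p" "p \<le> 1"
  shows "ad_generator p (u 0 x) w = ad_rate x w * (1 - p - of_bool (\<not> w x))"
  using ad_generator_eq_sum[OF finite_sites depends_on_u, of p 0 x w] assms
  by (simp add: site_average_eq)

text \<open>A move in one subtree leaves the indicator of the other fixed. The site x contributes
  nothing: a move there is legal only if both children are empty, and then extinction at depth n + 1
  holds whatever the value at x.\<close>

lemma ad_generator_u_Suc:
  assumes p: "0 \<le> p" "p \<le> 1"
  shows "ad_generator p (u (Suc n) x) w = of_bool (w x) *
    (ad_generator p (u n (True # x)) w * u n (False # x) w +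
     u n (True # x) w * ad_generator p (u n (False # x)) w)"
proof -
  let ?y = "True # x" and ?z = "False # x" and ?S = "sites (Suc n) x"
  let ?t = "\<lambda>f v. ad_rate v w * (site_average p v f w - f w)"
  have step: "?t (u (Suc n) x) v =
      of_bool (w x) * (?t (u n ?y) v * u n ?z w + u n ?y w * ?t (u n ?z) v)" if v: "v \<in> ?S" for v
  proof -
    note notin = site_average_notin[OF depends_on_u] depends_on_upd[OF depends_on_extinct]
    consider "v = x" | "v \<in> sites n ?y" | "v \<in> sites n ?z" using v by auto
    then show ?thesis
    proof cases
      case 1
      show ?thesis
      proof (cases "\<forall>b. \<not> w (b # x)")
        case True
        then have ext: "extinct (Suc n) x (w(x := b))" for b by (auto intro!: extinct_if_closed)
        have "site_average p x (u (Suc n) x) w = 1"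
          by (simp only: site_average_eq[OF p] ext of_bool_eq) simp
        moreover have "u (Suc n) x w = 1" using ext[of "w x"] by (simp del: extinct.simps)
        ultimately show ?thesis unfolding 1 by (simp add: notin del: extinct.simps)
      next
        case False
        then have "ad_rate x w = 0" by (simp add: ad_rate_eq)
        then show ?thesis unfolding 1 by (simp only: mult_zero_left mult_zero_right add_0_right)
      qed
    next
      case 2
      have z: "v \<notin> sites n ?z" using 2 sites_disjoint[of n x n] by blast
      have x: "v \<noteq> x" using 2 by auto
      have "site_average p v (u (Suc n) x) w =
          1 - of_bool (w x) + of_bool (w x) * (site_average p v (u n ?y) w * u n ?z w)"
        unfolding site_average_eq[OF p] u_Suc using x by (simp add: notin[OF z] algebra_simps)
      then show ?thesis unfolding u_Suc by (simp add: notin[OF z] algebra_simps)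
    next
      case 3
      have y: "v \<notin> sites n ?y" using 3 sites_disjoint[of n x n] by blast
      have x: "v \<noteq> x" using 3 by auto
      have "site_average p v (u (Suc n) x) w =
          1 - of_bool (w x) + of_bool (w x) * (u n ?y w * site_average p v (u n ?z) w)"
        unfolding site_average_eq[OF p] u_Suc using x by (simp add: notin[OF y] algebra_simps)
      then show ?thesis unfolding u_Suc by (simp add: notin[OF y] algebra_simps)
    qed
  qed
  have "depends_on ?S (u n ?y)" "depends_on ?S (u n ?z)"
    by (rule depends_on_mono[OF depends_on_u], auto)+
  note eqs = ad_generator_eq_sum[OF finite_sites this(1)] ad_generator_eq_sum[OF finite_sites this(2)]
    ad_generator_eq_sum[OF finite_sites depends_on_u, of p "Suc n" x]
  show ?thesis
    unfolding eqs sum_distrib_left sum_distrib_right sum.distrib[symmetric]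
    by (rule sum.cong[OF refl step])
qed

text \<open>A legal move can raise u_n only at a vertex v with empty children that lies on every
  path of n + 1 ones from x. Such paths end at v, so v is unique and there is no path of n + 2 ones,
  that is, u_(n+1) = 1. The product rule turns this into an induction.\<close>

lemma ad_generator_u_le:
  assumes p: "0 \<le> p" "p \<le> 1"
  shows "ad_generator p (u n x) w \<le> u (Suc n) x w - u n x w"
proof (induction n arbitrary: x)
  case 0
  show ?case
    unfolding ad_generator_u_0[OF p] using p by (auto simp: ad_rate_eq)
next
  case (Suc n)
  let ?y = "True # x" and ?z = "False # x"
  have mono: "extinct n v w \<longrightarrow> extinct (Suc n) v w" for v using extinct_Suc by blast
  show ?case
  proof (cases "w x")
    case True
    have "ad_generator p (u n ?y) w * u n ?z w + u n ?y w * ad_generator p (u n ?z) w \<le>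
        (u (Suc n) ?y w - u n ?y w) * u n ?z w + u n ?y w * (u (Suc n) ?z w - u n ?z w)"
      using Suc by (intro add_mono mult_left_mono mult_right_mono) auto
    \<comment> \<open>The difference of the two sides is the product of the two increments,
      nonnegative since u_n \<le> u_(n+1).\<close>
    also have "\<dots> \<le> u (Suc n) ?y w * u (Suc n) ?z w - u n ?y w * u n ?z w"
      using mono[of ?y] mono[of ?z] by (auto simp del: extinct.simps)
    finally show ?thesis
      unfolding ad_generator_u_Suc[OF p]
      unfolding u_Suc[of "Suc n"] u_Suc[of n x]
      using True by (simp del: extinct.simps)
  next
    case False
    then show ?thesis unfolding ad_generator_u_Suc[OF p] by simp
  qed
qed

text \<open>Since u_n is an indicator, u_n^2 = u_n, so the square of the product rule factorises
  over the subtrees. Its cross term is a product of means of u_n L u_n, which is why these means get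
  a recursion of their own.\<close>

lemma integral_u_generator_Suc:
  assumes p: "0 \<le> p" "p \<le> 1"
  defines "L \<equiv> \<lambda>n x. ad_generator p (u n x)"
  shows "(\<integral>w. u (Suc n) x w * L (Suc n) x w \<partial>bernoulli_product p) =
      p * extinction_prob p n *
        ((\<integral>w. u n (True # x) w * L n (True # x) w \<partial>bernoulli_product p) +
         (\<integral>w. u n (False # x) w * L n (False # x) w \<partial>bernoulli_product p))"
    and "(\<integral>w. (L (Suc n) x w)\<^sup>2 \<partial>bernoulli_product p) =
      p * (extinction_prob p n *
          ((\<integral>w. (L n (True # x) w)\<^sup>2 \<partial>bernoulli_product p) +
           (\<integral>w. (L n (False # x) w)\<^sup>2 \<partial>bernoulli_product p)) +
        2 * ((\<integral>w. u n (True # x) w * L n (True # x) w \<partial>bernoulli_product p) *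
           (\<integral>w. u n (False # x) w * L n (False # x) w \<partial>bernoulli_product p)))"
proof -
  let ?B = "bernoulli_product p" and ?y = "True # x" and ?z = "False # x"
  let ?e = "\<lambda>w. of_bool (w x) :: real"
  have u: "depends_on (sites (Suc n) v) (u n v)" for v
    by (rule depends_on_mono[OF depends_on_u sites_mono_Suc])
  have L: "depends_on (sites (Suc n) v) (L n v)" for v
    unfolding L_def by (rule depends_on_generator_u)
  have uL: "depends_on (sites (Suc n) v) (\<lambda>w. u n v w * L n v w)" for v
    by (intro depends_on_comp2[where h = "(*)"] u L)
  have L2: "depends_on (sites (Suc n) v) (\<lambda>w. (L n v w)\<^sup>2)" for v
    by (intro depends_on_comp[where h = "\<lambda>a. a\<^sup>2"] L)
  have int: "integrable ?B (\<lambda>w. ?e w * (F w * G w))"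
    if "depends_on (sites (Suc n) ?y) F" "depends_on (sites (Suc n) ?z) G" for F G
  proof (rule integrable_local)
    show "depends_on (sites (Suc (Suc n)) x) (\<lambda>w. ?e w * (F w * G w))"
      by (intro depends_on_comp2[where h = "(*)"] depends_on_mono[OF that(1)]
          depends_on_mono[OF that(2)]) (auto simp: depends_on_def)
  qed simp
  note mult = integral_site_mult[OF p, where m = "Suc n" and n = "Suc n"]
  have "(\<integral>w. u (Suc n) x w * L (Suc n) x w \<partial>?B) =
      (\<integral>w. ?e w * ((u n ?y w * L n ?y w) * u n ?z w) + ?e w * (u n ?y w * (u n ?z w * L n ?z w)) \<partial>?B)"
    unfolding L_def ad_generator_u_Suc[OF p] by (rule Bochner_Integration.integral_cong) auto
  also have "\<dots> = p * ((\<integral>w. u n ?y w * L n ?y w \<partial>?B) * extinction_prob p n) +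
      p * (extinction_prob p n * (\<integral>w. u n ?z w * L n ?z w \<partial>?B))"
    by (simp only: Bochner_Integration.integral_add int[OF uL u] int[OF u uL]
        mult[OF uL u] mult[OF u uL] integral_u[OF p])
  finally show "(\<integral>w. u (Suc n) x w * L (Suc n) x w \<partial>?B) = p * extinction_prob p n *
        ((\<integral>w. u n ?y w * L n ?y w \<partial>?B) + (\<integral>w. u n ?z w * L n ?z w \<partial>?B))"
    by (simp add: algebra_simps)
  have "(\<integral>w. (L (Suc n) x w)\<^sup>2 \<partial>?B) =
      (\<integral>w. ?e w * ((L n ?y w)\<^sup>2 * u n ?z w) + ?e w * (u n ?y w * (L n ?z w)\<^sup>2) +
        2 * (?e w * ((u n ?y w * L n ?y w) * (u n ?z w * L n ?z w))) \<partial>?B)"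
    unfolding L_def ad_generator_u_Suc[OF p]
    by (rule Bochner_Integration.integral_cong) (auto simp: power2_sum)
  also have "\<dots> = p * ((\<integral>w. (L n ?y w)\<^sup>2 \<partial>?B) * extinction_prob p n) +
      p * (extinction_prob p n * (\<integral>w. (L n ?z w)\<^sup>2 \<partial>?B)) +
      2 * (p * ((\<integral>w. u n ?y w * L n ?y w \<partial>?B) * (\<integral>w. u n ?z w * L n ?z w \<partial>?B)))"
    by (simp only: Bochner_Integration.integral_add Bochner_Integration.integrable_add
        integrable_mult_right Bochner_Integration.integral_mult_right_zero
        int[OF L2 u] int[OF u L2] int[OF uL uL]
        mult[OF L2 u] mult[OF u L2] mult[OF uL uL] integral_u[OF p])
  finally show "(\<integral>w. (L (Suc n) x w)\<^sup>2 \<partial>?B) =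
      p * (extinction_prob p n * ((\<integral>w. (L n ?y w)\<^sup>2 \<partial>?B) + (\<integral>w. (L n ?z w)\<^sup>2 \<partial>?B)) +
        2 * ((\<integral>w. u n ?y w * L n ?y w \<partial>?B) * (\<integral>w. u n ?z w * L n ?z w \<partial>?B)))"
    by (simp add: algebra_simps)
qed

text \<open>Each recursion sums over two children with weight p q_n \<le> 1 - p, hence the ratio r =
  2 (1 - p). The cross term of the second adds a source of order r^n at every level, whence the
  factor linear in n.\<close>

lemma generator_u_bounds:
  assumes p: "1/2 \<le> p" "p < 1"
  shows "\<bar>\<integral>w. u n x w * ad_generator p (u n x) w \<partial>bernoulli_product p\<bar> \<le> (2 * (1 - p)) ^ n"
    and "(\<integral>w. (ad_generator p (u n x) w)\<^sup>2 \<partial>bernoulli_product p) \<le>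
      (1 + p / (1 - p) * n) * (2 * (1 - p)) ^ n"
proof -
  let ?B = "bernoulli_product p"
  define r where "r = 2 * (1 - p)"
  have r: "0 \<le> r" "r \<le> 1" using p by (auto simp: r_def)
  have half_r: "1 - p = r / 2" by (simp add: r_def)
  have p': "0 \<le> p" "p \<le> 1" using p by auto
  define W where "W n x = (\<integral>w. u n x w * ad_generator p (u n x) w \<partial>?B)" for n x
  define V where "V n x = (\<integral>w. (ad_generator p (u n x) w)\<^sup>2 \<partial>?B)" for n x
  have bound0: "\<bar>ad_generator p (u 0 x) w\<bar> \<le> 1" for x w
    unfolding ad_generator_u_0[OF p'] using p by (auto simp: ad_rate_eq)
  have gen: "integrable ?B (\<lambda>w. h (ad_generator p (u n x) w))" for h :: "real \<Rightarrow> real" and n x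
    by (rule integrable_local[OF finite_sites depends_on_comp[OF depends_on_generator_u]])
  have q: "0 \<le> p * extinction_prob p n" "p * extinction_prob p n \<le> 1 - p" for n
    using extinction_prob_bounds[OF p', of n] extinction_prob_supercritical[OF p(1) p'(2)] p by auto
  have W: "\<bar>W n x\<bar> \<le> r ^ n" for n x
  proof (induction n arbitrary: x)
    case 0
    have "\<bar>W 0 x\<bar> \<le> (\<integral>w. \<bar>u 0 x w * ad_generator p (u 0 x) w\<bar> \<partial>?B)"
      unfolding W_def by (rule integral_abs_bound)
    also have "\<dots> \<le> (\<integral>w. 1 \<partial>?B)"
    proof (rule integral_mono_AE)
      show "integrable ?B (\<lambda>w. \<bar>u 0 x w * ad_generator p (u 0 x) w\<bar>)"
        by (intro integrable_abs integrable_local_mult[OF finite_sites depends_on_u] gen[of "\<lambda>a. a"])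
      show "AE w in ?B. \<bar>u 0 x w * ad_generator p (u 0 x) w\<bar> \<le> 1"
        using bound0[of x] by (intro AE_I2) (simp del: extinct.simps)
    qed simp
    finally show ?case by simp
  next
    case (Suc n)
    have "W (Suc n) x = p * extinction_prob p n * (W n (True # x) + W n (False # x))"
      unfolding W_def by (rule integral_u_generator_Suc(1)[OF p'])
    then have "\<bar>W (Suc n) x\<bar> = p * extinction_prob p n * \<bar>W n (True # x) + W n (False # x)\<bar>"
      by (simp only: abs_mult[of "p * extinction_prob p n"] abs_of_nonneg[OF q(1)])
    also have "\<dots> \<le> (1 - p) * (r ^ n + r ^ n)"
      using q[of n] Suc[of "True # x"] Suc[of "False # x"] p by (intro mult_mono) auto
    also have "\<dots> = r ^ Suc n" using half_r by simp
    finally show ?case .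
  qed
  then show "\<bar>\<integral>w. u n x w * ad_generator p (u n x) w \<partial>?B\<bar> \<le> (2 * (1 - p)) ^ n"
    by (simp add: W_def r_def)
  have "V n x \<le> (1 + p / (1 - p) * n) * r ^ n" for n x
  proof (induction n arbitrary: x)
    case 0
    have "V 0 x \<le> (\<integral>w. 1 \<partial>?B)" unfolding V_def
    proof (rule integral_mono_AE)
      show "AE w in ?B. (ad_generator p (u 0 x) w)\<^sup>2 \<le> 1"
        using bound0 by (intro AE_I2) (simp only: abs_square_le_1)
    qed (rule gen, simp)
    then show ?case by simp
  next
    case (Suc n)
    let ?A = "(1 + p / (1 - p) * n) * r ^ n"
    have "W n (True # x) * W n (False # x) \<le> r ^ n * r ^ n"
      using mult_mono[OF W[of n "True # x"] W[of n "False # x"]] r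
      by (simp add: abs_mult[symmetric])
    also have "\<dots> \<le> r ^ n * 1" using r by (intro mult_left_mono power_le_one) auto
    finally have WW: "W n (True # x) * W n (False # x) \<le> r ^ n" by simp
    have "V (Suc n) x = p * extinction_prob p n * (V n (True # x) + V n (False # x)) +
        2 * p * (W n (True # x) * W n (False # x))"
      unfolding V_def W_def integral_u_generator_Suc(2)[OF p'] by (simp add: algebra_simps)
    also have "\<dots> \<le> (1 - p) * (?A + ?A) + 2 * p * r ^ n"
    proof (intro add_mono mult_mono[of "p * extinction_prob p n"])
      show "0 \<le> V n (True # x) + V n (False # x)"
        unfolding V_def by (intro add_nonneg_nonneg integral_nonneg_AE) auto
      show "2 * p * (W n (True # x) * W n (False # x)) \<le> 2 * p * r ^ n"
        using WW p by (intro mult_left_mono) auto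
    qed (use q Suc p in auto)
    \<comment> \<open>As a multiple of r, the source term joins the power r^(n+1), and p / (1 - p)
      becomes the slope of the linear factor.\<close>
    also have "2 * p = p / (1 - p) * r" using p by (subst half_r) (simp add: r_def)
    also have "p / (1 - p) * r * r ^ n = p / (1 - p) * r ^ Suc n" by simp
    also have "(1 - p) * (?A + ?A) = (1 + p / (1 - p) * n) * r ^ Suc n"
      by (simp add: r_def)
    also have "\<dots> + p / (1 - p) * r ^ Suc n = (1 + p / (1 - p) * Suc n) * r ^ Suc n"
      by (simp only: of_nat_Suc ring_distribs mult_1_right mult_1_left add_ac)
    finally show ?case .
  qed
  then show "(\<integral>w. (ad_generator p (u n x) w)\<^sup>2 \<partial>?B) \<le> (1 + p / (1 - p) * n) * (2 * (1 - p)) ^ n"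
    by (simp add: V_def r_def)
qed

section \<open>The extinction indicator as a second element of the kernel\<close>

definition u_lim :: "vertex \<Rightarrow> config \<Rightarrow> real" where
  "u_lim x w = of_bool (\<exists>n. extinct n x w)"

lemma extinct_mono: "m \<le> n \<Longrightarrow> extinct m x w \<Longrightarrow> extinct n x w"
  by (induction n rule: dec_induct) (blast intro: extinct_Suc)+

lemma u_LIMSEQ: "(\<lambda>n. u n x w) \<longlonglongrightarrow> u_lim x w"
proof (cases "\<exists>n. extinct n x w")
  case True
  then obtain m where "extinct m x w" by blast
  then have "\<forall>n\<ge>m. u n x w = u_lim x w" unfolding u_lim_def by (auto dest: extinct_mono)
  then show ?thesis by (intro tendsto_eventually) (unfold eventually_sequentially, blast)
next
  case False
  then show ?thesis by (simp add: u_lim_def)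
qed

lemma measurable_u_lim: "u_lim x \<in> borel_measurable (bernoulli_product p)"
  by (rule borel_measurable_LIMSEQ_real[OF u_LIMSEQ measurable_u])

lemma extinction_prob_LIMSEQ:
  assumes "0 \<le> p" "p \<le> 1"
  shows "extinction_prob p \<longlonglongrightarrow> (\<integral>w. u_lim x w \<partial>bernoulli_product p)"
  unfolding integral_u[OF assms, of _ x, symmetric]
  by (rule integral_dominated_convergence[where w = "\<lambda>_. 1"])
    (auto simp: u_LIMSEQ measurable_u_lim measurable_u)

lemma ad_L2_graph_u_lim:
  assumes p: "1/2 < p" "p < 1"
  shows "ad_L2_graph p (u_lim x) (\<lambda>_. 0)"
  unfolding ad_L2_graph_def
proof (intro conjI exI[of _ "\<lambda>n. u n x"])
  let ?B = "bernoulli_product p"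
  show "in_L2 p (u_lim x)"
    unfolding in_L2_def
  proof
    have "norm ((u_lim x w)\<^sup>2) \<le> 1" for w by (simp add: u_lim_def)
    then show "integrable ?B (\<lambda>w. (u_lim x w)\<^sup>2)"
      by (intro bernoulli.integrable_const_bound[of _ 1] borel_measurable_power measurable_u_lim) simp
  qed (rule measurable_u_lim)
  show "in_L2 p (\<lambda>_. 0)" by (simp add: in_L2_def)
  show "\<forall>n. local_function (u n x)"
    using depends_on_u finite_sites unfolding local_function_iff by blast
  have "(\<lambda>n. \<integral>w. (u n x w - u_lim x w)\<^sup>2 \<partial>?B) \<longlonglongrightarrow> (\<integral>w. 0 \<partial>?B)"
  proof (rule integral_dominated_convergence[where w = "\<lambda>_. 1"])
    show "AE w in ?B. (\<lambda>n. (u n x w - u_lim x w)\<^sup>2) \<longlonglongrightarrow> 0"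
    proof (rule AE_I2)
      fix w show "(\<lambda>n. (u n x w - u_lim x w)\<^sup>2) \<longlonglongrightarrow> 0"
        using tendsto_power[OF tendsto_diff[OF u_LIMSEQ tendsto_const, of x w "u_lim x w"], of 2] by simp
    qed
    show "AE w in ?B. norm ((u n x w - u_lim x w)\<^sup>2) \<le> 1" for n
      by (rule AE_I2) (auto simp: u_lim_def)
    show "(\<lambda>w. (u n x w - u_lim x w)\<^sup>2) \<in> borel_measurable ?B" for n
      by (intro borel_measurable_power borel_measurable_diff measurable_u measurable_u_lim)
  qed auto
  then show "(\<lambda>n. \<integral>w. (u n x w - u_lim x w)\<^sup>2 \<partial>?B) \<longlonglongrightarrow> 0" by simp
  show "(\<lambda>n. \<integral>w. (ad_generator p (u n x) w - 0)\<^sup>2 \<partial>?B) \<longlonglongrightarrow> 0"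
  proof (rule tendsto_sandwich)
    show "\<forall>\<^sub>F n in sequentially. 0 \<le> (\<integral>w. (ad_generator p (u n x) w - 0)\<^sup>2 \<partial>?B)"
      by (intro always_eventually allI integral_nonneg_AE) simp
    show "\<forall>\<^sub>F n in sequentially. (\<integral>w. (ad_generator p (u n x) w - 0)\<^sup>2 \<partial>?B) \<le>
        (1 + p / (1 - p) * n) * (2 * (1 - p)) ^ n"
      using generator_u_bounds(2)[of p _ x] p by simp
    have r: "\<bar>2 * (1 - p)\<bar> < 1" using p by auto
    have "(\<lambda>n. (2 * (1 - p)) ^ n + p / (1 - p) * (real n * (2 * (1 - p)) ^ n)) \<longlonglongrightarrow> 0 + p / (1 - p) * 0"
      using r powser_times_n_limit_0[of "2 * (1 - p)"] by (intro tendsto_intros LIMSEQ_power_zero) auto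
    then show "(\<lambda>n. (1 + p / (1 - p) * real n) * (2 * (1 - p)) ^ n) \<longlonglongrightarrow> 0"
      by (simp add: algebra_simps)
  qed simp
qed

text \<open>A one-dimensional kernel containing both 1 and the extinction indicator makes the latter
  almost surely constant, hence 0 or 1. But its mean lies between 1 - p > 0 and (1 - p) / p <
  1.\<close>

lemma not_simple_eigenvalue_supercritical:
  assumes p: "1/2 < p" "p < 1"
  shows "\<not> ad_simple_eigenvalue p 0"
proof
  let ?B = "bernoulli_product p"
  assume "ad_simple_eigenvalue p 0"
  then obtain f where f: "\<And>g. ad_L2_graph p g (\<lambda>_. 0) \<Longrightarrow> \<exists>a. AE w in ?B. g w = a * f w"
    by (auto simp: ad_simple_eigenvalue_def)
  obtain a where a: "AE w in ?B. 1 = a * f w" using f[OF ad_L2_graph_const] by blast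
  obtain b where b: "AE w in ?B. u_lim [] w = b * f w" using f[OF ad_L2_graph_u_lim[OF p]] by blast
  from a b have AE: "AE w in ?B. u_lim [] w = b / a" 
    by eventually_elim (cases "a = 0"; simp add: nonzero_eq_divide_eq mult_ac)
  then have "(\<integral>w. u_lim [] w \<partial>?B) = (\<integral>w. b / a \<partial>?B)"
    using measurable_u_lim by (intro integral_cong_AE) auto
  then have int: "(\<integral>w. u_lim [] w \<partial>?B) = b / a" by simp
  have u_lim_cases: "u_lim [] w = 0 \<or> u_lim [] w = 1" for w by (auto simp: u_lim_def)
  from AE have "AE w in ?B. b / a = 0 \<or> b / a = 1"
  proof eventually_elim
    case (elim w)
    show ?case using u_lim_cases[of w] unfolding elim .
  qed
  then have cases: "b / a = 0 \<or> b / a = 1" by simp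
  have lim: "extinction_prob p \<longlonglongrightarrow> b / a"
    using extinction_prob_LIMSEQ[of p "[]"] p unfolding int by simp
  have "1 - p \<le> b / a"
  proof (rule LIMSEQ_le_const[OF lim])
    have "1 - p \<le> extinction_prob p n" for n using p by (cases n) auto
    then show "\<exists>N. \<forall>n\<ge>N. 1 - p \<le> extinction_prob p n" by blast
  qed
  moreover have "p * (b / a) \<le> 1 - p"
    by (rule LIMSEQ_le_const2[OF tendsto_mult_left[OF lim]])
      (use extinction_prob_supercritical[of p] p in auto)
  ultimately show False using cases p by auto
qed

lemma ad_threshold_eq: "ad_threshold = 1/2"
proof -
  let ?S = "{p. 0 \<le> p \<and> p < 1 \<and> ad_simple_eigenvalue p 0}"
  have mem: "p \<in> ?S" if "0 \<le> p" "p < 1/2" for p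
    using that simple_eigenvalue_subcritical by auto
  have upper: "p \<le> 1/2" if "p \<in> ?S" for p
    using that not_simple_eigenvalue_supercritical[of p] by force
  have "Sup ?S = 1/2"
  proof (rule cSup_eq_non_empty)
    have "0 \<in> ?S" by (rule mem) auto
    then show "?S \<noteq> {}" by blast
    show "1/2 \<le> y" if y: "\<And>p. p \<in> ?S \<Longrightarrow> p \<le> y" for y
    proof (rule dense_le)
      fix z :: real assume "z < 1/2"
      then show "z \<le> y" using y[OF mem[of z]] y[OF mem[of 0]] by (cases "0 \<le> z") auto
    qed
  qed (rule upper)
  then show ?thesis by (simp add: ad_threshold_def)
qed

section \<open>Frozen infinite clusters\<close>

lemma subalgebra_natural_sigma:
  assumes "\<And>u. 0 \<le> u \<Longrightarrow> X u \<in> measurable N borel"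
  shows "subalgebra N (natural_sigma N X s)"
proof -
  have "{X u -` B \<inter> space N | u B. 0 \<le> u \<and> u \<le> s \<and> B \<in> sets borel} \<subseteq> sets N"
    using assms by (auto intro: measurable_sets)
  then show ?thesis
    unfolding subalgebra_def natural_sigma_def
    by (intro conjI) (auto intro!: space_measure_of sets.sigma_sets_subset
        dest: sets.sets_into_space simp: sets_measure_of_conv)
qed

section \<open>The transition semigroup of a Feller process\<close>

locale feller_process =
  fixes M :: "config \<Rightarrow> 'w measure" and X :: "real \<Rightarrow> 'w \<Rightarrow> config"
  assumes feller: "feller_markov_process M X"
begin

lemma prob_space_M: "prob_space (M \<eta>)"
  and measurable_X: "0 \<le> t \<Longrightarrow> X t \<in> measurable (M \<eta>) borel"
  and AE_start: "AE w in M \<eta>. X 0 w = \<eta>"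
  and continuous_transition:
    "0 \<le> t \<Longrightarrow> continuous_on UNIV f \<Longrightarrow> continuous_on UNIV (transition M X t f)"
  and markov: "0 \<le> s \<Longrightarrow> 0 \<le> t \<Longrightarrow> continuous_on UNIV f \<Longrightarrow> AE w in M \<eta>.
    real_cond_exp (M \<eta>) (natural_sigma (M \<eta>) X s) (\<lambda>w. f (X (s + t) w)) w
      = transition M X t f (X s w)"
  using feller by (auto simp: feller_markov_process_def)

lemma measurable_comp_X:
  fixes g :: "config \<Rightarrow> real"
  assumes "0 \<le> t" "continuous_on UNIV g"
  shows "(\<lambda>w. g (X t w)) \<in> borel_measurable (M \<eta>)"
  using measurable_X[OF assms(1)] borel_measurable_continuous_onI[OF assms(2)]
  by (rule measurable_compose)

lemma integrable_comp_X:
  fixes g :: "config \<Rightarrow> real"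
  assumes "0 \<le> t" "continuous_on UNIV g" "\<And>\<xi>. \<bar>g \<xi>\<bar> \<le> C"
  shows "integrable (M \<eta>) (\<lambda>w. g (X t w))"
proof -
  interpret prob_space "M \<eta>" by (rule prob_space_M)
  show ?thesis
    using assms(3) by (intro integrable_const_bound[of _ C] measurable_comp_X assms(1,2)) auto
qed

lemma transition_mono:
  assumes "0 \<le> t" "continuous_on UNIV f" "continuous_on UNIV g"
    and "\<And>\<xi>. \<bar>f \<xi>\<bar> \<le> C" "\<And>\<xi>. \<bar>g \<xi>\<bar> \<le> C'" "\<And>\<xi>. f \<xi> \<le> g \<xi>"
  shows "transition M X t f \<eta> \<le> transition M X t g \<eta>"
  unfolding transition_def
  by (intro integral_mono integrable_comp_X[OF assms(1,2,4)] integrable_comp_X[OF assms(1,3,5)] assms(6))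

lemma transition_const: "transition M X t (\<lambda>_. a) \<eta> = a"
  using prob_space.prob_space[OF prob_space_M[of \<eta>]] by (simp add: transition_def)

lemma transition_0: "continuous_on UNIV f \<Longrightarrow> transition M X 0 f \<eta> = f \<eta>"
proof -
  assume f: "continuous_on UNIV f"
  have "transition M X 0 f \<eta> = (\<integral>w. f \<eta> \<partial>M \<eta>)"
    unfolding transition_def using AE_start[of \<eta>]
    by (intro integral_cong_AE measurable_comp_X f) auto
  then show ?thesis using prob_space.prob_space[OF prob_space_M[of \<eta>]] by simp
qed

lemma transition_bounds:
  assumes "0 \<le> t" "continuous_on UNIV f" "\<And>\<xi>. 0 \<le> f \<xi>" "\<And>\<xi>. f \<xi> \<le> 1"
  shows "0 \<le> transition M X t f \<eta>" "transition M X t f \<eta> \<le> 1"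
proof -
  have b: "\<bar>f \<xi>\<bar> \<le> 1" for \<xi> using assms(3,4)[of \<xi>] by simp
  show "0 \<le> transition M X t f \<eta>"
    using transition_mono[of t "\<lambda>_. 0" f 0 1 \<eta>] assms b by (simp add: transition_const)
  show "transition M X t f \<eta> \<le> 1"
    using transition_mono[of t f "\<lambda>_. 1" 1 1 \<eta>] assms b by (simp add: transition_const)
qed

text \<open>Integrate the Markov property: a conditional expectation has the mean of the original
  variable.\<close>

lemma transition_add:
  assumes "0 \<le> s" "0 \<le> t" and f: "continuous_on UNIV f" "\<And>\<xi>. \<bar>f \<xi>\<bar> \<le> C"
  shows "transition M X (s + t) f \<eta> = transition M X s (transition M X t f) \<eta>"
proof -
  let ?F = "natural_sigma (M \<eta>) X s"
  interpret prob_space "M \<eta>" by (rule prob_space_M)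
  interpret finite_measure_subalgebra "M \<eta>" ?F
    by unfold_locales (rule subalgebra_natural_sigma[OF measurable_X])
  have int: "integrable (M \<eta>) (\<lambda>w. f (X (s + t) w))"
    using assms by (intro integrable_comp_X[of _ _ C]) auto
  have "transition M X (s + t) f \<eta> = (\<integral>w. real_cond_exp (M \<eta>) ?F (\<lambda>w. f (X (s + t) w)) w \<partial>M \<eta>)"
    unfolding transition_def by (rule real_cond_exp_int(2)[OF int, symmetric])
  also have "\<dots> = (\<integral>w. transition M X t f (X s w) \<partial>M \<eta>)"
    using assms by (intro integral_cong_AE markov measurable_comp_X continuous_transition) auto
  finally show ?thesis by (simp add: transition_def)
qed

end

text \<open>The first two terms of the binomial expansion. They make t^(k+1) / (k+1)! a
  supersolution of the Euler scheme with increments h t^k / k!.\<close>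

lemma power_Suc_add_ge:
  fixes a h :: real
  assumes "0 \<le> a" "0 \<le> h"
  shows "a ^ Suc k + real (Suc k) * h * a ^ k \<le> (a + h) ^ Suc k"
proof (induction k)
  case (Suc k)
  have "a ^ Suc (Suc k) + real (Suc (Suc k)) * h * a ^ Suc k \<le>
      (a ^ Suc k + real (Suc k) * h * a ^ k) * (a + h)"
    using assms by (simp add: algebra_simps)
  also have "\<dots> \<le> (a + h) ^ Suc k * (a + h)"
    using Suc assms by (intro mult_right_mono) auto
  finally show ?case by (simp add: mult.commute)
qed simp

lemma power_div_fact_step:
  fixes a h :: real
  assumes "0 \<le> a" "0 \<le> h"
  shows "a ^ Suc k / fact (Suc k) + h * (a ^ k / fact k) \<le> (a + h) ^ Suc k / fact (Suc k)"
proof -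
  have "h * (a ^ k / fact k) = real (Suc k) * h * a ^ k / fact (Suc k)"
    by (simp only: fact_Suc mult.assoc) (simp del: of_nat_Suc)
  then have "a ^ Suc k / fact (Suc k) + h * (a ^ k / fact k) =
      (a ^ Suc k + real (Suc k) * h * a ^ k) / fact (Suc k)"
    by (simp only: add_divide_distrib)
  also have "\<dots> \<le> (a + h) ^ Suc k / fact (Suc k)"
    using power_Suc_add_ge[OF assms] by (intro divide_right_mono) auto
  finally show ?thesis .
qed

locale ad_model = feller_process M X
  for M :: "config \<Rightarrow> 'w measure" and X :: "real \<Rightarrow> 'w \<Rightarrow> config" +
  fixes p :: real
  assumes p: "0 \<le> p" "p \<le> 1" and process: "ad_process p M X"
begin

lemma continuous_u: "continuous_on UNIV (u n x)"
  by (rule continuous_on_local[OF finite_sites depends_on_u])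

text \<open>Near time 0 the generator controls u_n uniformly in the starting point. The semigroup
  preserves order and carries the estimate to any time t, so one \<delta> serves all t and \<eta>,
  as the Euler scheme requires.\<close>

lemma transition_u_step:
  assumes "\<epsilon> > 0"
  shows "\<exists>\<delta>>0. \<forall>h t \<eta>. 0 < h \<and> h < \<delta> \<and> 0 \<le> t \<longrightarrow> transition M X (t + h) (u n x) \<eta> \<le>
    transition M X t (u n x) \<eta> + h * (transition M X t (u (Suc n) x) \<eta> + \<epsilon>)"
proof -
  have "local_function (u n x)"
    using depends_on_u finite_sites unfolding local_function_iff by blast
  then have "uniform_limit UNIV (\<lambda>t \<eta>. (transition M X t (u n x) \<eta> - u n x \<eta>) / t)
      (ad_generator p (u n x)) (at_right 0)"
    using process by (simp add: ad_process_def)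
  from uniform_limitD[OF this assms] obtain \<delta> where \<delta>: "\<delta> > 0"
    "\<And>h \<xi>. 0 < h \<Longrightarrow> h < \<delta> \<Longrightarrow>
      dist ((transition M X h (u n x) \<xi> - u n x \<xi>) / h) (ad_generator p (u n x) \<xi>) < \<epsilon>"
    unfolding eventually_at_right_field by auto
  show ?thesis
  proof (intro exI[of _ \<delta>] conjI allI impI \<delta>(1))
    fix h t :: real and \<eta> assume "0 < h \<and> h < \<delta> \<and> 0 \<le> t"
    then have h: "0 < h" "h < \<delta>" and t: "0 \<le> t" by auto
    have le: "transition M X h (u n x) \<xi> \<le> u n x \<xi> + h * (u (Suc n) x \<xi> + \<epsilon>)" for \<xi>
    proof -
      have "(transition M X h (u n x) \<xi> - u n x \<xi>) / h \<le> ad_generator p (u n x) \<xi> + \<epsilon>"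
        using \<delta>(2)[OF h, of \<xi>] by (simp add: dist_real_def)
      also have "\<dots> \<le> u (Suc n) x \<xi> + \<epsilon>"
      proof -
        have "0 \<le> u n x \<xi>" by simp
        then show ?thesis using ad_generator_u_le[OF p, of n x \<xi>] by linarith
      qed
      finally have "transition M X h (u n x) \<xi> - u n x \<xi> \<le> (u (Suc n) x \<xi> + \<epsilon>) * h"
        using h by (simp only: pos_divide_le_eq)
      then show ?thesis by (simp only: mult.commute[of h])
    qed
    let ?g = "\<lambda>\<xi>. u n x \<xi> + h * (u (Suc n) x \<xi> + \<epsilon>)"
    have int: "integrable (M \<eta>) (\<lambda>w. u m x (X t w))" for m
      by (rule integrable_comp_X[OF t continuous_u, of _ _ 1]) simp
    interpret prob_space "M \<eta>" by (rule prob_space_M)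
    have "transition M X (t + h) (u n x) \<eta> = transition M X t (transition M X h (u n x)) \<eta>"
      using t h by (intro transition_add[of _ _ _ 1] continuous_u) auto
    also have "\<dots> \<le> transition M X t ?g \<eta>"
    proof (rule transition_mono[OF t _ _ _ _ le])
      show "continuous_on UNIV (transition M X h (u n x))"
        using h by (intro continuous_transition continuous_u) auto
      show "continuous_on UNIV ?g" by (intro continuous_intros continuous_u)
      show "\<bar>transition M X h (u n x) \<xi>\<bar> \<le> 1" for \<xi>
        using transition_bounds[OF _ continuous_u, of h n x \<xi>] h by simp
      show "\<bar>?g \<xi>\<bar> \<le> 1 + h * (1 + \<epsilon>)" for \<xi>
        using h mult_pos_pos[OF h(1) assms] by (simp add: ring_distribs del: extinct.simps)
    qed
    also have "\<dots> = transition M X t (u n x) \<eta> + h * (transition M X t (u (Suc n) x) \<eta> + \<epsilon>)"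
      unfolding transition_def using int[of n] int[of "Suc n"] prob_space
      by (simp del: extinct.simps)
    finally show "transition M X (t + h) (u n x) \<eta> \<le>
      transition M X t (u n x) \<eta> + h * (transition M X t (u (Suc n) x) \<eta> + \<epsilon>)" .
  qed
qed

text \<open>
  An infinite path of ones starting at \<open>x\<close> is frozen. Quantitatively, \<open>\<L> u\<^sub>n \<le> u\<^sub>n\<^sub>+\<^sub>1\<close>,
  so an Euler scheme improves the trivial bound 1 to \<open>t\<^sup>k / k!\<close> in \<open>k\<close> steps.
\<close>

lemma transition_u_le_power:
  assumes surv: "\<And>n. \<not> extinct n x \<eta>" and "0 \<le> t"
  shows "transition M X t (u n x) \<eta> \<le> t ^ k / fact k"
  using \<open>0 \<le> t\<close>
proof (induction k arbitrary: n t)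
  case 0
  then show ?case using transition_bounds(2)[OF _ continuous_u, of t n x \<eta>] by simp
next
  case (Suc k)
  note outer_IH = Suc.IH
  show ?case
  proof (cases "t = 0")
    case True
    then show ?thesis using surv by (simp add: transition_0[OF continuous_u])
  next
    case False
    with Suc.prems have t: "t > 0" by simp
    show ?thesis
    proof (rule field_le_epsilon)
      fix e :: real assume "e > 0"
      \<comment> \<open>The m steps of length h = t / m accumulate the error m h \<epsilon> = t
        \<epsilon> = e.\<close>
      define \<epsilon> where "\<epsilon> = e / t"
      have "\<epsilon> > 0" using \<open>e > 0\<close> t by (simp add: \<epsilon>_def)
      from transition_u_step[OF this, of n x] obtain \<delta> where \<delta>: "\<delta> > 0"
        "\<And>h t. 0 < h \<Longrightarrow> h < \<delta> \<Longrightarrow> 0 \<le> t \<Longrightarrow> transition M X (t + h) (u n x) \<eta> \<le>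
          transition M X t (u n x) \<eta> + h * (transition M X t (u (Suc n) x) \<eta> + \<epsilon>)"
        by blast
      obtain m :: nat where m: "t / \<delta> < real m" using reals_Archimedean2 by blast
      moreover have "0 < t / \<delta>" using t \<delta>(1) by simp
      ultimately have "0 < real m" by linarith
      then have "m > 0" by simp
      define h where "h = t / real m"
      have h: "0 < h" "h < \<delta>" using t \<delta>(1) m \<open>m > 0\<close> by (auto simp: h_def field_simps)
      have "transition M X (j * h) (u n x) \<eta> \<le> (j * h) ^ Suc k / fact (Suc k) + j * h * \<epsilon>" for j :: nat
      proof (induction j)
        case 0
        then show ?case using surv by (simp add: transition_0[OF continuous_u])
      next
        case (Suc j)
        let ?a = "real j * h"
        have a: "0 \<le> ?a" using h by simp
        have "transition M X (?a + h) (u n x) \<eta> \<le>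
            transition M X ?a (u n x) \<eta> + h * (transition M X ?a (u (Suc n) x) \<eta> + \<epsilon>)"
          by (rule \<delta>(2)[OF h a])
        \<comment> \<open>The bound for k is used at depth n + 1: each further power of t costs one
          level, and an infinite path has levels without end.\<close>
        also have "\<dots> \<le> (?a ^ Suc k / fact (Suc k) + ?a * \<epsilon>) + h * (?a ^ k / fact k + \<epsilon>)"
          using h by (intro add_mono mult_left_mono Suc.IH order.refl outer_IH a) auto
        also have "\<dots> = (?a ^ Suc k / fact (Suc k) + h * (?a ^ k / fact k)) + (?a + h) * \<epsilon>"
          by (simp only: ring_distribs add_ac)
        also have "\<dots> \<le> (?a + h) ^ Suc k / fact (Suc k) + (?a + h) * \<epsilon>"
          using power_div_fact_step[OF a, of h k] h by (intro add_right_mono) auto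
        also have "?a + h = real (Suc j) * h" by (simp add: ring_distribs)
        finally show ?case .
      qed
      from this[of m] show "transition M X t (u n x) \<eta> \<le> t ^ Suc k / fact (Suc k) + e"
        using t \<open>m > 0\<close> by (simp add: h_def \<epsilon>_def del: fact_Suc power_Suc)
    qed
  qed
qed

text \<open>For a survivor the bounds t^k / k! hold for all k at fixed n and t, and they tend to
  0.\<close>

lemma transition_u_le_u_lim:
  assumes "0 \<le> t"
  shows "transition M X t (u n x) \<eta> \<le> u_lim x \<eta>"
proof (cases "\<exists>m. extinct m x \<eta>")
  case True
  then show ?thesis using transition_bounds(2)[OF assms continuous_u] by (simp add: u_lim_def)
next
  case False
  have "(\<lambda>k. t ^ k / fact k) \<longlonglongrightarrow> 0"
    using summable_LIMSEQ_zero[OF summable_exp[of t]] by (simp add: divide_inverse mult.commute)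
  then have "transition M X t (u n x) \<eta> \<le> 0"
    by (rule LIMSEQ_le_const) (use False transition_u_le_power[OF _ assms] in blast)
  then show ?thesis using False by (simp add: u_lim_def)
qed

lemma integrable_transition_u:
  assumes "0 \<le> t"
  shows "integrable (bernoulli_product p') (transition M X t (u n x))"
  using transition_bounds[OF assms continuous_u]
  by (intro bernoulli.integrable_const_bound[of _ 1] AE_I2 borel_measurable_bernoulli_product
      continuous_transition assms continuous_u) auto

lemma integral_transition_u_le:
  assumes "0 \<le> t"
  shows "(\<integral>\<eta>. transition M X t (u n x) \<eta> \<partial>bernoulli_product p') \<le>
    (\<integral>\<eta>. u_lim x \<eta> \<partial>bernoulli_product p')"
proof (intro integral_mono integrable_transition_u transition_u_le_u_lim assms)
  show "integrable (bernoulli_product p') (u_lim x)"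
    by (rule bernoulli.integrable_const_bound[of _ 1]) (auto simp: measurable_u_lim, simp add: u_lim_def)
qed

end

theorem theorem4p4:
  fixes p p' c :: real
    and M :: "config \<Rightarrow> 'w measure"
    and X :: "real \<Rightarrow> 'w \<Rightarrow> config"
  assumes "0 \<le> p" and "p \<le> 1" and "0 \<le> p'" and "p' \<le> 1"
    and "ad_process p M X"
    and "p \<le> ad_threshold" and "ad_threshold < p'"
    and "c > 0"
  shows "\<exists>f. local_function f \<and>
    (\<forall>t>0. \<bar>\<integral>\<eta>. (\<integral>w. (f (X t w) - (\<integral>\<omega>. f \<omega> \<partial>bernoulli_product p)) \<partial>M \<eta>)
              \<partial>bernoulli_product p'\<bar> \<ge> c)"
proof -
  interpret ad_model M X p
    using assms by unfold_locales (auto simp: ad_process_def)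
  have p2: "p \<le> 1/2" and p': "1/2 < p'" using assms ad_threshold_eq by auto
  \<comment> \<open>The extinction probability for p', at most (1 - p') / p' < 1. It bounds the mean
    of u_n under the process started from \<nu>, for all n and t.\<close>
  define a where "a = (\<integral>\<eta>. u_lim [] \<eta> \<partial>bernoulli_product p')"
  have "p' * a \<le> 1 - p'"
    by (rule LIMSEQ_le_const2[OF tendsto_mult_left[OF extinction_prob_LIMSEQ[of p' "[]", folded a_def]]])
      (use extinction_prob_supercritical[of p'] p' assms in auto)
  also have "\<dots> < p' * 1" using p' by simp
  finally have "a < 1" using p' by (simp only: mult_less_cancel_left_pos)
  then have "\<forall>\<^sub>F n in sequentially. a < extinction_prob p n"
    using extinction_prob_subcritical_LIMSEQ[OF assms(1) p2] by (auto dest: order_tendstoD)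
  then obtain n where n: "a < extinction_prob p n"
    using eventually_happens by force
  \<comment> \<open>At all times the mean of u_n under \<mu> exceeds that under the process by at
    least \<open>extinction_prob p n - a\<close>; K scales this gap to c.\<close>
  define K where "K = c / (extinction_prob p n - a)"
  have K: "K > 0" "K * (a - extinction_prob p n) = - c"
    using n \<open>c > 0\<close> by (auto simp: K_def field_simps)
  define f where "f = (\<lambda>w. K * u n [] w)"
  have "depends_on (sites n []) f"
    unfolding f_def by (rule depends_on_comp[OF depends_on_u])
  then have "local_function f" using finite_sites unfolding local_function_iff by blast
  moreover have "c \<le> \<bar>\<integral>\<eta>. (\<integral>w. (f (X t w) - (\<integral>w. f w \<partial>bernoulli_product p)) \<partial>M \<eta>)
      \<partial>bernoulli_product p'\<bar>" if "t > 0" for t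
  proof -
    have t: "0 \<le> t" using that by simp
    have mean: "(\<integral>w. f w \<partial>bernoulli_product p) = K * extinction_prob p n"
      by (simp add: f_def integral_u[OF p])
    have inner: "(\<integral>w. (f (X t w) - (\<integral>w. f w \<partial>bernoulli_product p)) \<partial>M \<eta>) =
        K * transition M X t (u n []) \<eta> - K * extinction_prob p n" for \<eta>
    proof -
      interpret prob_space "M \<eta>" by (rule prob_space_M)
      have "integrable (M \<eta>) (\<lambda>w. u n [] (X t w))"
        by (rule integrable_comp_X[OF t continuous_u, of _ _ 1]) simp
      then show ?thesis unfolding mean using prob_space by (simp add: f_def transition_def)
    qed
    have "(\<integral>\<eta>. (\<integral>w. (f (X t w) - (\<integral>w. f w \<partial>bernoulli_product p)) \<partial>M \<eta>) \<partial>bernoulli_product p') =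
        K * (\<integral>\<eta>. transition M X t (u n []) \<eta> \<partial>bernoulli_product p') - K * extinction_prob p n"
      unfolding inner using integrable_transition_u[OF t, of p' n "[]"] by simp
    also have "\<dots> \<le> K * a - K * extinction_prob p n"
      using K(1) integral_transition_u_le[OF t, of p' n "[]"] unfolding a_def
      by (intro diff_right_mono mult_left_mono) auto
    also have "\<dots> = - c" using K(2) by (simp add: algebra_simps)
    finally show ?thesis by linarith
  qed
  ultimately show ?thesis by blast
qed

end
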